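(* Let $G_n$ denote the smallest integer such that for every finite family $\mathcal{F}$ of pairwise intersecting closed balls in $\mathbb{E}^n$ there exists a set $P\subset\mathbb{E}^n$ of cardinality $G_n$ which pierces $\mathcal{F}$. Then, as $n\to\infty$, $$G_n\le \left(\sqrt{3/2}+o(1)\right)^n,$$ i.e., any finite family of pairwise intersecting closed balls in $\mathbb{E}^n$ can be pierced by $(\sqrt{3/2}+o(1))^n$ points.
   Context: $\mathbb{E}^n$ is $n$-dimensional Euclidean space. A set of points $P$ pierces a collection of sets $\mathcal{F}$ if $P\cap F\neq\emptyset$ for every $F\in\mathcal{F}$. The balls in a family may have different radii. The term $o(1)$ denotes a quantity depending only on $n$ and tending to $0$ as $n\to\infty$. *)

theory Defs
  imports "HOL-Analysis.Analysis" "HOL-Library.Landau_Symbols"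
begin

text \<open>
  The dimension varies inside the statement, so n-dimensional Euclidean space is the carrier
  \<open>topspace (Euclidean_space n)\<close>, the real sequences vanishing from index \<open>n\<close> on, with the
  Euclidean metric on the first \<open>n\<close> coordinates.
\<close>

abbreviation euclid :: "nat \<Rightarrow> (nat \<Rightarrow> real) set"
  where "euclid n \<equiv> topspace (Euclidean_space n)"

definition euclid_dist :: "nat \<Rightarrow> (nat \<Rightarrow> real) \<Rightarrow> (nat \<Rightarrow> real) \<Rightarrow> real"
  where "euclid_dist n x y = L2_set (\<lambda>i. x i - y i) {..<n}"

interpretation euclid: Metric_space "euclid n" "euclid_dist n" for n
proof
  fix x y z :: "nat \<Rightarrow> real"
  show "0 \<le> euclid_dist n x y"
    by (simp add: euclid_dist_def)
  show "euclid_dist n x y = euclid_dist n y x"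
    by (simp add: euclid_dist_def L2_set_def power2_commute)
  show "euclid_dist n x y = 0 \<longleftrightarrow> x = y" if "x \<in> euclid n" "y \<in> euclid n"
  proof
    assume "euclid_dist n x y = 0"
    then have "\<forall>i<n. x i = y i"
      by (simp add: euclid_dist_def L2_set_eq_0_iff)
    moreover have "\<forall>i\<ge>n. x i = y i"
      using that by (simp add: topspace_Euclidean_space)
    ultimately show "x = y"
      by (metis ext not_le)
  qed (simp add: euclid_dist_def L2_set_def)
  show "euclid_dist n x z \<le> euclid_dist n x y + euclid_dist n y z"
    using L2_set_triangle_ineq[of "\<lambda>i. x i - y i" "\<lambda>i. y i - z i" "{..<n}"]
    by (simp add: euclid_dist_def)
qed

definition is_closed_ball :: "nat \<Rightarrow> (nat \<Rightarrow> real) set \<Rightarrow> bool"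
  where "is_closed_ball n B \<longleftrightarrow> (\<exists>c\<in>euclid n. \<exists>r>0. B = euclid.mcball n c r)"

definition pierces :: "'a set \<Rightarrow> 'a set set \<Rightarrow> bool"
  where "pierces P \<F> \<longleftrightarrow> (\<forall>F\<in>\<F>. P \<inter> F \<noteq> {})"

definition intersecting_ball_family :: "nat \<Rightarrow> (nat \<Rightarrow> real) set set \<Rightarrow> bool"
  where "intersecting_ball_family n \<F> \<longleftrightarrow>
    finite \<F> \<and> (\<forall>B\<in>\<F>. is_closed_ball n B) \<and> pairwise (\<lambda>A B. A \<inter> B \<noteq> {}) \<F>"

definition suffices_to_pierce :: "nat \<Rightarrow> nat \<Rightarrow> bool"
  where "suffices_to_pierce n k \<longleftrightarrow>
    (\<forall>\<F>. intersecting_ball_family n \<F> \<longrightarrow>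
      (\<exists>P. P \<subseteq> euclid n \<and> finite P \<and> card P = k \<and> pierces P \<F>))"

text \<open>
  \<open>LEAST\<close> is only meaningful if some \<open>k\<close> suffices; a theorem about this number should also assert
  \<open>suffices_to_pierce n (ball_piercing_number n)\<close>.
\<close>

definition ball_piercing_number :: "nat \<Rightarrow> nat"
  where "ball_piercing_number n = (LEAST k. suffices_to_pierce n k)"

end

theory Submission imports Defs
begin

text \<open>
  Write \<open>|x - y|\<close> for \<open>euclid_dist n x y\<close>. The core of the argument is that a finite set \<open>A\<close>
  whose points are pairwise at distance at most \<open>2 * a\<close>, with \<open>a\<close> close to 1, must have a
  large share of its points, up to a polynomial factor \<open>(sqrt (3/2)) ^ - n\<close> of them, in a
  single unit ball (\<open>card_le_unit_ball_count\<close>). The bound comes from comparing volumes.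

  Suppose that no unit ball holds more than \<open>D\<close> points of \<open>A\<close>. For \<open>x\<close> in \<open>A\<close> and \<open>v\<close> in the
  unit ball, let the ball through \<open>x\<close> with centre \<open>x + s v\<close> grow by letting \<open>s\<close> run through
  the powers of \<open>1 + 1/n\<close>. At \<open>s = 1\<close> it holds at most \<open>D\<close> points of \<open>A\<close>, and there is a
  last moment before it holds more, unless \<open>s\<close> passes \<open>a * n\<close> first, when all distances in
  \<open>A\<close> are negligible and the ball stops growing. Sort the vectors \<open>v\<close> by this moment; as
  there are only polynomially many moments, a single one, \<open>s\<close>, accounts for a large part of
  the volume. Let \<open>Z x\<close> be the set of all centres \<open>x + s v\<close> belonging to it. A point \<open>z\<close>
  lies in at most \<open>D\<close> of these sets: if \<open>x\<close> is the farthest point of \<open>A\<close> with \<open>z\<close> in \<open>Z x\<close>,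
  then all the others are in the ball through \<open>x\<close> around \<open>z\<close>, which holds at most \<open>D\<close> points
  (\<open>tangent_pieces_multiplicity\<close>). So \<open>card A * s ^ n\<close> is, up to a polynomial factor, at
  most \<open>D\<close> times the volume of \<open>Y\<close>, the union of the \<open>Z x\<close>, in units of the volume of the
  unit ball.

  On the other hand \<open>Y\<close> has small diameter. Consider a moment \<open>s\<close> followed by an excess.
  Around each \<open>z\<close> in \<open>Y\<close>, a ball of radius only slightly larger than \<open>s\<close> holds more than \<open>D\<close>
  points of \<open>A\<close>, hence a subset \<open>X\<close> of \<open>A\<close> that fits in no unit ball. Let \<open>c\<close> be the centre
  of the smallest ball enclosing \<open>X\<close>. Since the points of \<open>X\<close> on its boundary lie in no open
  half-space bounded by a hyperplane through \<open>c\<close>, for every point \<open>q\<close> there is \<open>x\<close> in \<open>X\<close>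
  with \<open>|x - q|\<^sup>2 \<ge> |q - c|\<^sup>2 + 1\<close>. Applied to \<open>z\<close> and to a second such centre, this bounds
  \<open>|z - c|\<close> by about \<open>sqrt (s\<^sup>2 - 1)\<close> and the distance of any two such centres by \<open>sqrt (4 *
  a\<^sup>2 - 2)\<close>, so \<open>Y\<close> has diameter at most about \<open>2 * s * sqrt (a\<^sup>2 + 1/2)\<close>
  (\<open>circumcentres_close\<close>). If the growth has stopped at \<open>s \<ge> a * n\<close>, the diameter is at most
  \<open>2 * (s + a)\<close> because \<open>Y\<close> is within distance \<open>s\<close> of \<open>A\<close>, and \<open>s + a\<close> exceeds \<open>s\<close> only by a
  factor \<open>1 + 1/n\<close>. By the isodiametric inequality (\<open>isodiametric\<close>, through Steiner
  symmetrization) the volume of \<open>Y\<close> is at most about \<open>(s * sqrt (a\<^sup>2 + 1/2)) ^ n\<close> unit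
  balls. The powers of \<open>s\<close> cancel, and for \<open>a = 1 + O(1/n)\<close> what is left is \<open>(sqrt (3/2)) ^
  n\<close> up to a constant.

  Taking crowded balls greedily turns this into a cover of \<open>A\<close> by few balls, at the price of
  a factor \<open>ln (card A)\<close>, and replacing \<open>A\<close> by a net makes this factor polynomial in \<open>n\<close>
  (\<open>cover_by_equal_balls\<close>). This pierces every family of pairwise intersecting balls with
  nearly equal radii: their centres are at distance at most twice the radius or a little
  more, and a point pierces a ball if it is within the radius of its centre. In a general
  family with smallest radius \<open>\<rho>\<close>, polynomially many such classes exhaust the radii up to
  \<open>(n + 1) * \<rho>\<close>. Every larger ball contains a ball of radius \<open>n * \<rho>\<close> near the smallest ball,
  and these form one more class (\<open>pierce_by_centres\<close>).
\<close>

section \<open>Lebesgue measure on coordinate functions\<close>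

definition coord_lebesgue :: "nat set \<Rightarrow> (nat \<Rightarrow> real) measure"
  where "coord_lebesgue I = (\<Pi>\<^sub>M i\<in>I. lborel)"

interpretation reals: product_sigma_finite "\<lambda>_::nat. lborel :: real measure"
  by unfold_locales

lemma space_coord_lebesgue: "space (coord_lebesgue I) = extensional I"
  by (simp add: coord_lebesgue_def space_PiM PiE_def)

lemma measurable_coordinate [measurable]:
  "i \<in> I \<Longrightarrow> (\<lambda>x. x i) \<in> borel_measurable (coord_lebesgue I)"
  unfolding coord_lebesgue_def using measurable_component_singleton[of i I "\<lambda>_. lborel :: real measure"] by simp

lemma measurable_update_coordinate [measurable]:
  assumes "i \<in> I"
  shows "(\<lambda>(x, t). x(i := t)) \<in> coord_lebesgue I \<Otimes>\<^sub>M lborel \<rightarrow>\<^sub>M coord_lebesgue I"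
  unfolding coord_lebesgue_def
proof (rule measurable_PiM_single')
  show "(\<lambda>p. (case p of (x, t) \<Rightarrow> x(i := t)) j) \<in> Pi\<^sub>M I (\<lambda>_. lborel) \<Otimes>\<^sub>M lborel \<rightarrow>\<^sub>M lborel" if "j \<in> I" for j
    using that by (cases "j = i") (auto simp: case_prod_beta)
qed (use assms in \<open>auto simp: space_pair_measure space_PiM PiE_def extensional_def\<close>)

lemma measurable_slice:
  assumes "i \<in> I" "Y \<in> sets (coord_lebesgue I)" "x \<in> space (coord_lebesgue I)"
  shows "{t. x(i := t) \<in> Y} \<in> sets (lborel :: real measure)"
proof -
  have "(\<lambda>t. (case (x, t) of (x, t) \<Rightarrow> x(i := t))) \<in> lborel \<rightarrow>\<^sub>M coord_lebesgue I"
    by (rule measurable_compose[OF _ measurable_update_coordinate[OF assms(1)]]) (use assms(3) in measurable)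
  from measurable_sets[OF this assms(2)] show ?thesis
    by (simp add: vimage_def)
qed

definition slice_length :: "nat \<Rightarrow> (nat \<Rightarrow> real) set \<Rightarrow> (nat \<Rightarrow> real) \<Rightarrow> ennreal"
  where "slice_length i Y x = emeasure lborel {t. x(i := t) \<in> Y}"

lemma slice_length_update [simp]: "slice_length i Y (x(i := t)) = slice_length i Y x"
  by (simp add: slice_length_def)

lemma measurable_slice_length:
  assumes "i \<in> I" "Y \<in> sets (coord_lebesgue I)"
  shows "slice_length i Y \<in> borel_measurable (coord_lebesgue I)"
proof -
  let ?Q = "(\<lambda>(x, t). x(i := t)) -` Y \<inter> space (coord_lebesgue I \<Otimes>\<^sub>M lborel)"
  have Q: "?Q \<in> sets (coord_lebesgue I \<Otimes>\<^sub>M lborel)"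
    using measurable_sets[OF measurable_update_coordinate[OF assms(1)] assms(2)] .
  have "(\<lambda>x. emeasure lborel (Pair x -` ?Q)) \<in> borel_measurable (coord_lebesgue I)"
    using lborel.measurable_emeasure_Pair[OF Q] .
  moreover have "emeasure lborel (Pair x -` ?Q) = slice_length i Y x" if "x \<in> space (coord_lebesgue I)" for x
    using that by (auto simp: slice_length_def space_pair_measure vimage_def intro!: arg_cong[where f="emeasure lborel"])
  ultimately show ?thesis
    by (simp cong: measurable_cong)
qed

text \<open>
  Tonelli's theorem with the coordinate \<open>i\<close> singled out, the form in which Steiner
  symmetrization uses it.
\<close>

lemma emeasure_eq_integral_slice_length:
  assumes "finite I" "i \<in> I" "Y \<in> sets (coord_lebesgue I)"
  shows "emeasure (coord_lebesgue I) Y = (\<integral>\<^sup>+x. slice_length i Y x \<partial>coord_lebesgue (I - {i}))"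
proof -
  have I: "insert i (I - {i}) = I" using assms by auto
  have Y: "Y \<in> sets (Pi\<^sub>M (insert i (I - {i})) (\<lambda>_. lborel))"
    using assms I by (simp add: coord_lebesgue_def)
  have "emeasure (coord_lebesgue I) Y = (\<integral>\<^sup>+x. indicator Y x \<partial>Pi\<^sub>M (insert i (I - {i})) (\<lambda>_. lborel))"
    using assms(3) I by (simp add: coord_lebesgue_def)
  also have "\<dots> = (\<integral>\<^sup>+x. (\<integral>\<^sup>+t. indicator Y (x(i := t)) \<partial>lborel) \<partial>coord_lebesgue (I - {i}))"
    unfolding coord_lebesgue_def
    by (rule reals.product_nn_integral_insert) (use assms Y in \<open>auto\<close>)
  also have "\<dots> = (\<integral>\<^sup>+x. slice_length i Y x \<partial>coord_lebesgue (I - {i}))"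
  proof (rule nn_integral_cong)
    fix x assume x: "x \<in> space (coord_lebesgue (I - {i}))"
    have "{t. x(i := t) \<in> Y} = {t. (x(i := 0))(i := t) \<in> Y}" by simp
    also have "\<dots> \<in> sets lborel"
      by (rule measurable_slice[OF assms(2,3)])
         (use x assms(2) in \<open>auto simp: space_coord_lebesgue extensional_def\<close>)
    finally have "{t. x(i := t) \<in> Y} \<in> sets lborel" .
    then have "(\<integral>\<^sup>+t. indicator {t. x(i := t) \<in> Y} t \<partial>lborel) = slice_length i Y x"
      by (simp add: slice_length_def)
    then show "(\<integral>\<^sup>+t. indicator Y (x(i := t)) \<partial>lborel) = slice_length i Y x"
      by (simp add: indicator_def)
  qed
  finally show ?thesis .
qed

section \<open>Steiner symmetrization and the isodiametric inequality\<close>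

text \<open>
  Each line in direction \<open>i\<close> meets the symmetrized set in the open interval centred at 0
  whose length is the measure of the line's intersection with \<open>Y\<close>. Empty slices give empty
  intervals because the inequality is strict.
\<close>

definition steiner :: "nat set \<Rightarrow> nat \<Rightarrow> (nat \<Rightarrow> real) set \<Rightarrow> (nat \<Rightarrow> real) set"
  where "steiner I i Y = {x \<in> space (coord_lebesgue I). ennreal (2 * \<bar>x i\<bar>) < slice_length i Y x}"

lemma steiner_sets:
  assumes "i \<in> I" "Y \<in> sets (coord_lebesgue I)"
  shows "steiner I i Y \<in> sets (coord_lebesgue I)"
proof -
  have [measurable]: "slice_length i Y \<in> borel_measurable (coord_lebesgue I)"
    using measurable_slice_length[OF assms] .
  have [measurable]: "(\<lambda>x. x i) \<in> borel_measurable (coord_lebesgue I)"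
    using assms by measurable
  show ?thesis unfolding steiner_def by measurable
qed

lemma emeasure_centred_interval:
  "emeasure lborel {t. ennreal (2 * \<bar>t\<bar>) < l} = l"
proof (cases l)
  case (real r)
  then have "{t. ennreal (2 * \<bar>t\<bar>) < l} = {- r/2 <..< r/2}"
    by (auto simp: ennreal_less_iff abs_less_iff)
  with real show ?thesis by simp
next
  case top
  then show ?thesis by (simp add: emeasure_lborel_UNIV)
qed

lemma emeasure_steiner:
  assumes "finite I" "i \<in> I" "Y \<in> sets (coord_lebesgue I)"
  shows "emeasure (coord_lebesgue I) (steiner I i Y) = emeasure (coord_lebesgue I) Y"
proof -
  have "slice_length i (steiner I i Y) x = slice_length i Y x" if "x \<in> space (coord_lebesgue (I - {i}))" for x
  proof -
    have "x(i := t) \<in> space (coord_lebesgue I)" for t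
      using that assms(2) by (auto simp: space_coord_lebesgue extensional_def)
    then have "{t. x(i := t) \<in> steiner I i Y} = {t. ennreal (2 * \<bar>t\<bar>) < slice_length i Y x}"
      by (simp add: steiner_def)
    then have "slice_length i (steiner I i Y) x = emeasure lborel {t. ennreal (2 * \<bar>t\<bar>) < slice_length i Y x}"
      unfolding slice_length_def[of i "steiner I i Y"] by simp
    then show ?thesis by (simp add: emeasure_centred_interval)
  qed
  then show ?thesis
    unfolding emeasure_eq_integral_slice_length[OF assms]
      emeasure_eq_integral_slice_length[OF assms(1,2) steiner_sets[OF assms(2,3)]]
    by (intro nn_integral_cong)
qed

text \<open>
  A set without two points more than \<open>c\<close> apart lies in an interval of length \<open>c\<close>.
\<close>

lemma spread_points_of_emeasure:
  assumes "0 \<le> c" "ennreal c < emeasure lborel S"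
  obtains s t :: real where "s \<in> S" "t \<in> S" "c < t - s"
proof (rule ccontr)
  assume "\<not> thesis"
  with that have le: "t - s \<le> c" if "s \<in> S" "t \<in> S" for s t
    using that not_le by blast
  from assms have "S \<noteq> {}" by auto
  then obtain s0 where s0: "s0 \<in> S" by auto
  have bdd: "bdd_below S"
    by (rule bdd_belowI[of _ "s0 - c"]) (use le s0 in force)
  have "S \<subseteq> {Inf S .. Inf S + c}"
  proof
    fix t assume t: "t \<in> S"
    have "t - c \<le> Inf S"
      by (rule cInf_greatest) (use \<open>S \<noteq> {}\<close> le t in force)+
    then show "t \<in> {Inf S .. Inf S + c}" using t bdd cInf_lower by auto
  qed
  then have "emeasure lborel S \<le> emeasure lborel {Inf S .. Inf S + c}"
    by (rule emeasure_mono) simp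
  also have "\<dots> = ennreal c" using assms by simp
  finally show False using assms by simp
qed

definition sq_dist :: "nat set \<Rightarrow> (nat \<Rightarrow> real) \<Rightarrow> (nat \<Rightarrow> real) \<Rightarrow> real"
  where "sq_dist I x y = (\<Sum>i\<in>I. (x i - y i)\<^sup>2)"

text \<open>
  The slices of \<open>Y\<close> through \<open>x\<close> and \<open>y\<close> contain points \<open>s < t\<close> and \<open>s' < t'\<close> which are
  spread by more than \<open>2 * |x i|\<close> and \<open>2 * |y i|\<close>. Of the differences \<open>t - s'\<close> and \<open>t' - s\<close>,
  the larger is at least half their sum, hence at least \<open>|x i| + |y i|\<close>: symmetrizing does
  not increase the diameter.
\<close>

lemma steiner_sq_dist:
  assumes "finite I" "i \<in> I" and Y: "\<And>x y. x \<in> Y \<Longrightarrow> y \<in> Y \<Longrightarrow> sq_dist I x y \<le> B"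
    and "x \<in> steiner I i Y" "y \<in> steiner I i Y"
  shows "sq_dist I x y \<le> B"
proof -
  obtain s t where st: "x(i := s) \<in> Y" "x(i := t) \<in> Y" "2 * \<bar>x i\<bar> < t - s"
    using assms(4) spread_points_of_emeasure[of "2 * \<bar>x i\<bar>" "{t. x(i := t) \<in> Y}"]
    by (auto simp: steiner_def slice_length_def)
  obtain s' t' where st': "y(i := s') \<in> Y" "y(i := t') \<in> Y" "2 * \<bar>y i\<bar> < t' - s'"
    using assms(5) spread_points_of_emeasure[of "2 * \<bar>y i\<bar>" "{t. y(i := t) \<in> Y}"]
    by (auto simp: steiner_def slice_length_def)
  have "\<bar>x i\<bar> + \<bar>y i\<bar> \<le> t - s' \<or> \<bar>x i\<bar> + \<bar>y i\<bar> \<le> t' - s" using st st' by linarith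
  then obtain p q where pq: "x(i := p) \<in> Y" "y(i := q) \<in> Y" "\<bar>x i - y i\<bar> \<le> \<bar>p - q\<bar>"
  proof
    assume "\<bar>x i\<bar> + \<bar>y i\<bar> \<le> t - s'"
    then show ?thesis using st st' that[of t s'] by linarith
  next
    assume "\<bar>x i\<bar> + \<bar>y i\<bar> \<le> t' - s"
    then show ?thesis using st st' that[of s t'] by linarith
  qed
  have "sq_dist I x y = (x i - y i)\<^sup>2 + (\<Sum>j\<in>I - {i}. (x j - y j)\<^sup>2)"
    using assms(1,2) by (simp add: sq_dist_def sum.remove)
  also have "\<dots> \<le> (p - q)\<^sup>2 + (\<Sum>j\<in>I - {i}. (x j - y j)\<^sup>2)"
    using pq(3) by (simp add: abs_le_square_iff)
  also have "\<dots> = sq_dist I (x(i := p)) (y(i := q))"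
    using assms(1,2) by (simp add: sq_dist_def sum.remove)
  also have "\<dots> \<le> B" using Y pq by blast
  finally show ?thesis .
qed

lemma steiner_flip_same:
  assumes "i \<in> I" "x \<in> steiner I i Y"
  shows "x(i := - x i) \<in> steiner I i Y"
  using assms by (auto simp: steiner_def space_coord_lebesgue extensional_def)

lemma steiner_flip_other:
  assumes "i \<noteq> j" "j \<in> I" and flip: "\<And>x. x \<in> Y \<Longrightarrow> x(j := - x j) \<in> Y" and "x \<in> steiner I i Y"
  shows "x(j := - x j) \<in> steiner I i Y"
proof -
  have "(x(j := - x j))(i := t) \<in> Y \<longleftrightarrow> x(i := t) \<in> Y" for t
    using flip[of "x(i := t)"] flip[of "(x(j := - x j))(i := t)"] assms(1)
    by (simp add: fun_upd_twist[of i j]) (metis fun_upd_triv fun_upd_other fun_upd_twist)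
  then have "slice_length i Y (x(j := - x j)) = slice_length i Y x"
    by (simp add: slice_length_def)
  with assms show ?thesis
    by (auto simp: steiner_def space_coord_lebesgue extensional_def)
qed

text \<open>
  After symmetrization in every coordinate the set is invariant under every change of sign,
  because a symmetrization keeps the symmetries obtained before it. In particular the set
  contains \<open>-x\<close> together with \<open>x\<close>, so the diameter bound says that \<open>(2 * |x|)\<^sup>2 \<le> (2 * h)\<^sup>2\<close>
  for its points \<open>x\<close>. Every step keeps the volume and the diameter bound.
\<close>

theorem isodiametric:
  assumes "finite I" and Y: "Y \<in> sets (coord_lebesgue I)"
    and diam: "\<And>x y. x \<in> Y \<Longrightarrow> y \<in> Y \<Longrightarrow> sq_dist I x y \<le> (2 * h)\<^sup>2"
  shows "emeasure (coord_lebesgue I) Y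
    \<le> emeasure (coord_lebesgue I) {x \<in> space (coord_lebesgue I). sq_dist I x (\<lambda>_. 0) \<le> h\<^sup>2}"
proof -
  have "\<exists>Z \<in> sets (coord_lebesgue I). emeasure (coord_lebesgue I) Z = emeasure (coord_lebesgue I) Y
    \<and> (\<forall>x\<in>Z. \<forall>y\<in>Z. sq_dist I x y \<le> (2 * h)\<^sup>2) \<and> (\<forall>j\<in>J. \<forall>x\<in>Z. x(j := - x j) \<in> Z)" if "J \<subseteq> I" for J
    using finite_subset[OF that assms(1)] that
  proof (induction J)
    case empty
    then show ?case using Y diam by (intro bexI[of _ Y]) auto
  next
    case (insert i J)
    then obtain Z where Z: "Z \<in> sets (coord_lebesgue I)" "emeasure (coord_lebesgue I) Z = emeasure (coord_lebesgue I) Y"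
      "\<And>x y. x \<in> Z \<Longrightarrow> y \<in> Z \<Longrightarrow> sq_dist I x y \<le> (2 * h)\<^sup>2" "\<And>j x. j \<in> J \<Longrightarrow> x \<in> Z \<Longrightarrow> x(j := - x j) \<in> Z"
      using insert.IH insert.prems by blast
    from insert have i: "i \<in> I" by auto
    show ?case
    proof (intro bexI[of _ "steiner I i Z"] conjI ballI)
      show "x(j := - x j) \<in> steiner I i Z" if "j \<in> insert i J" "x \<in> steiner I i Z" for j x
      proof (cases "j = i")
        case True
        then show ?thesis using steiner_flip_same[OF i] that by simp
      next
        case False
        then show ?thesis using steiner_flip_other[of i j I Z x] Z(4) that insert.prems by auto
      qed
    next
      show "emeasure (coord_lebesgue I) (steiner I i Z) = emeasure (coord_lebesgue I) Y"
        using emeasure_steiner[OF assms(1) i Z(1)] Z(2) by simp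
    qed (use steiner_sets[OF i Z(1)] steiner_sq_dist[OF assms(1) i Z(3)] in blast)+
  qed
  from this[of I] obtain Z where Z: "Z \<in> sets (coord_lebesgue I)" "emeasure (coord_lebesgue I) Z = emeasure (coord_lebesgue I) Y"
    "\<And>x y. x \<in> Z \<Longrightarrow> y \<in> Z \<Longrightarrow> sq_dist I x y \<le> (2 * h)\<^sup>2" "\<And>j x. j \<in> I \<Longrightarrow> x \<in> Z \<Longrightarrow> x(j := - x j) \<in> Z"
    by auto
  \<comment> \<open>Points are undefined outside \<open>I\<close>, so the antipode of \<open>x\<close> changes signs on \<open>I\<close> only.\<close>
  have neg: "(\<lambda>i. if i \<in> J then - x i else x i) \<in> Z" if "x \<in> Z" "J \<subseteq> I" for x J
    using finite_subset[OF that(2) assms(1)] that(2)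
  proof (induction J)
    case (insert j J)
    let ?y = "\<lambda>i. if i \<in> J then - x i else x i"
    have "?y(j := - ?y j) \<in> Z" by (rule Z(4)) (use insert in auto)
    moreover have "?y(j := - ?y j) = (\<lambda>i. if i \<in> insert j J then - x i else x i)"
      using insert(2) by (auto simp: fun_eq_iff)
    ultimately show ?case by simp
  qed (use that in simp)
  have "Z \<subseteq> {x \<in> space (coord_lebesgue I). sq_dist I x (\<lambda>_. 0) \<le> h\<^sup>2}"
  proof (intro subsetI CollectI conjI)
    fix x assume x: "x \<in> Z"
    show "x \<in> space (coord_lebesgue I)" using x sets.sets_into_space[OF Z(1)] by auto
    have "sq_dist I x (\<lambda>i. if i \<in> I then - x i else x i) = (\<Sum>i\<in>I. 4 * (x i)\<^sup>2)"
      unfolding sq_dist_def by (intro sum.cong) (auto simp: power2_eq_square)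
    also have "\<dots> = 4 * sq_dist I x (\<lambda>_. 0)" by (simp add: sq_dist_def sum_distrib_left)
    finally show "sq_dist I x (\<lambda>_. 0) \<le> h\<^sup>2"
      using Z(3)[OF x neg[OF x subset_refl]] by (simp add: power2_eq_square)
  qed
  moreover have "{x \<in> space (coord_lebesgue I). sq_dist I x (\<lambda>_. 0) \<le> h\<^sup>2} \<in> sets (coord_lebesgue I)"
    unfolding sq_dist_def by measurable
  ultimately show ?thesis using Z(2) emeasure_mono by metis
qed

section \<open>Homotheties and volumes of balls\<close>

text \<open>
  The homothety taking the ball of radius \<open>s\<close> around \<open>c\<close> to the unit ball around the origin,
  so that a preimage under it is a translate by \<open>c\<close> of a copy enlarged by \<open>s\<close>.
\<close>

definition rescale :: "nat set \<Rightarrow> (nat \<Rightarrow> real) \<Rightarrow> real \<Rightarrow> (nat \<Rightarrow> real) \<Rightarrow> nat \<Rightarrow> real"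
  where "rescale I c s z = (\<lambda>i\<in>I. (z i - c i) / s)"

lemma measurable_rescale [measurable]:
  "rescale I c s \<in> coord_lebesgue I \<rightarrow>\<^sub>M coord_lebesgue I"
  unfolding rescale_def coord_lebesgue_def by measurable

lemma emeasure_lborel_rescale_preimage:
  assumes "0 < s" "A \<in> sets borel"
  shows "emeasure lborel {t :: real. (t - c) / s \<in> A} = ennreal s * emeasure lborel A"
proof -
  have "lborel = density (distr lborel borel (\<lambda>t. - c / s + (1 / s) * t)) (\<lambda>_. ennreal \<bar>1 / s\<bar>)"
    using assms by (intro lborel_real_affine) simp
  then have "emeasure lborel A = emeasure (density (distr lborel borel (\<lambda>t. - c / s + (1 / s) * t)) (\<lambda>_. ennreal \<bar>1 / s\<bar>)) A"
    by simp
  also have "\<dots> = ennreal (1 / s) * emeasure lborel ((\<lambda>t. - c / s + (1 / s) * t) -` A)"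
    using assms by (simp add: emeasure_density nn_integral_cmult_indicator emeasure_distr)
  also have "(\<lambda>t. - c / s + (1 / s) * t) -` A = {t. (t - c) / s \<in> A}"
    by (simp add: vimage_def diff_divide_distrib)
  finally have "ennreal s * emeasure lborel A = (ennreal s * ennreal (1 / s)) * emeasure lborel {t. (t - c) / s \<in> A}"
    by (simp add: mult.assoc)
  then show ?thesis using assms by (simp flip: ennreal_mult)
qed

lemma emeasure_rescale_preimage:
  assumes "finite I" "0 < s" and V: "V \<in> sets (coord_lebesgue I)"
  shows "emeasure (coord_lebesgue I) {z \<in> space (coord_lebesgue I). rescale I c s z \<in> V}
    = ennreal (s ^ card I) * emeasure (coord_lebesgue I) V"
proof -
  let ?L = "coord_lebesgue I" and ?T = "rescale I c s"
  have "scale_measure (ennreal (1 / s ^ card I)) (distr ?L ?L ?T) = Pi\<^sub>M I (\<lambda>_. lborel)"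
  proof (rule reals.PiM_eqI)
    fix A :: "nat \<Rightarrow> real set" assume A: "\<And>i. i \<in> I \<Longrightarrow> A i \<in> sets lborel"
    then have PA: "Pi\<^sub>E I A \<in> sets ?L"
      using assms(1) by (auto simp: coord_lebesgue_def intro: sets_PiM_I_finite)
    have "?T -` Pi\<^sub>E I A \<inter> space ?L = (\<Pi>\<^sub>E i\<in>I. {t. (t - c i) / s \<in> A i})"
      by (auto simp: rescale_def space_coord_lebesgue PiE_iff extensional_def)
    moreover have "{t. (t - c i) / s \<in> A i} \<in> sets lborel" if "i \<in> I" for i
    proof -
      have "(\<lambda>t. (t - c i) / s) -` A i \<inter> space lborel \<in> sets lborel"
        by (rule measurable_sets[of _ lborel borel]) (use A that in auto)
      then show ?thesis by (simp add: vimage_def)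
    qed
    ultimately have "emeasure ?L (?T -` Pi\<^sub>E I A \<inter> space ?L) = (\<Prod>i\<in>I. emeasure lborel {t. (t - c i) / s \<in> A i})"
      unfolding coord_lebesgue_def using assms(1) by (simp add: reals.emeasure_PiM)
    also have "\<dots> = (\<Prod>i\<in>I. ennreal s * emeasure lborel (A i))"
      using A by (intro prod.cong refl emeasure_lborel_rescale_preimage assms) auto
    also have "\<dots> = ennreal (s ^ card I) * (\<Prod>i\<in>I. emeasure lborel (A i))"
      using assms(2) by (simp add: prod.distrib ennreal_power)
    finally have "emeasure (scale_measure (ennreal (1 / s ^ card I)) (distr ?L ?L ?T)) (Pi\<^sub>E I A)
      = (ennreal (1 / s ^ card I) * ennreal (s ^ card I)) * (\<Prod>i\<in>I. emeasure lborel (A i))"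
      using PA by (simp add: emeasure_distr mult.assoc)
    then show "emeasure (scale_measure (ennreal (1 / s ^ card I)) (distr ?L ?L ?T)) (Pi\<^sub>E I A)
      = (\<Prod>i\<in>I. emeasure lborel (A i))"
      using assms(2) by (simp flip: ennreal_mult)
  qed (use assms in \<open>simp_all add: coord_lebesgue_def\<close>)
  then have "emeasure ?L V = emeasure (scale_measure (ennreal (1 / s ^ card I)) (distr ?L ?L ?T)) V"
    by (simp add: coord_lebesgue_def)
  also have "\<dots> = ennreal (1 / s ^ card I) * emeasure ?L (?T -` V \<inter> space ?L)"
    using V by (simp add: emeasure_distr)
  finally have "ennreal (s ^ card I) * emeasure ?L V
    = (ennreal (s ^ card I) * ennreal (1 / s ^ card I)) * emeasure ?L (?T -` V \<inter> space ?L)"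
    by (simp add: mult.assoc)
  also have "\<dots> = emeasure ?L (?T -` V \<inter> space ?L)"
    using assms(2) by (simp flip: ennreal_mult)
  finally show ?thesis by (simp add: vimage_def Int_def conj_commute)
qed

definition origin_ball :: "nat set \<Rightarrow> real \<Rightarrow> (nat \<Rightarrow> real) set"
  where "origin_ball I h = {x \<in> space (coord_lebesgue I). sq_dist I x (\<lambda>_. 0) \<le> h\<^sup>2}"

lemma origin_ball_sets [measurable]: "origin_ball I h \<in> sets (coord_lebesgue I)"
  unfolding origin_ball_def sq_dist_def by measurable

lemma emeasure_origin_ball:
  assumes "finite I" "0 < h"
  shows "emeasure (coord_lebesgue I) (origin_ball I h)
    = ennreal (h ^ card I) * emeasure (coord_lebesgue I) (origin_ball I 1)"
proof -
  have "sq_dist I (rescale I (\<lambda>_. 0) h z) (\<lambda>_. 0) = sq_dist I z (\<lambda>_. 0) / h\<^sup>2" for z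
    by (simp add: sq_dist_def rescale_def power_divide sum_divide_distrib)
  then have "origin_ball I h = {z \<in> space (coord_lebesgue I). rescale I (\<lambda>_. 0) h z \<in> origin_ball I 1}"
    using assms(2) by (auto simp: origin_ball_def space_coord_lebesgue rescale_def)
  then show ?thesis using emeasure_rescale_preimage[OF assms origin_ball_sets[of I 1], of "\<lambda>_. 0"] by simp
qed

lemma emeasure_unit_ball_finite:
  assumes "finite I"
  shows "emeasure (coord_lebesgue I) (origin_ball I 1) < \<infinity>"
proof -
  have "\<bar>x i\<bar> \<le> 1" if "x \<in> origin_ball I 1" "i \<in> I" for x i
  proof -
    have "(x i)\<^sup>2 \<le> 1"
      using that member_le_sum[OF that(2), of "\<lambda>i. (x i)\<^sup>2"] assms by (auto simp: origin_ball_def sq_dist_def)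
    then show ?thesis by (simp add: abs_square_le_1)
  qed
  then have "x i \<in> {-1..1}" if "x \<in> origin_ball I 1" "i \<in> I" for x i
    using that by (simp add: abs_le_iff minus_le_iff)
  then have "origin_ball I 1 \<subseteq> (\<Pi>\<^sub>E i\<in>I. {-1..1})"
    unfolding PiE_iff subset_iff by (simp add: origin_ball_def space_coord_lebesgue)
  then have "emeasure (coord_lebesgue I) (origin_ball I 1) \<le> emeasure (coord_lebesgue I) (\<Pi>\<^sub>E i\<in>I. {-1..1})"
    using assms by (intro emeasure_mono) (auto simp: coord_lebesgue_def intro!: sets_PiM_I_finite)
  also have "\<dots> = (\<Prod>i\<in>I. 2)"
    using assms unfolding coord_lebesgue_def by (subst reals.emeasure_PiM) auto
  also have "\<dots> < \<infinity>"
    by (simp add: power_less_top_ennreal)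
  finally show ?thesis .
qed

text \<open>
  The unit ball contains a cube with side \<open>2 / (1 + card I)\<close>.
\<close>

lemma emeasure_unit_ball_pos:
  assumes "finite I"
  shows "0 < emeasure (coord_lebesgue I) (origin_ball I 1)"
proof -
  define \<delta> where "\<delta> = 1 / (1 + real (card I))"
  have \<delta>: "0 < \<delta>" "\<delta> \<le> 1" "real (card I) * \<delta> \<le> 1" by (auto simp: \<delta>_def field_simps)
  have "sq_dist I x (\<lambda>_. 0) \<le> 1" if "x \<in> (\<Pi>\<^sub>E i\<in>I. {-\<delta>..\<delta>})" for x
  proof -
    have "(x i)\<^sup>2 \<le> \<delta>" if "i \<in> I" for i
    proof -
      have "\<bar>x i\<bar> \<le> \<delta>" using that \<open>x \<in> _\<close> by (auto simp: PiE_iff abs_le_iff)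
      then have "\<bar>x i\<bar> * \<bar>x i\<bar> \<le> \<delta> * 1" using \<delta> by (intro mult_mono) auto
      then show ?thesis by (simp add: power2_eq_square flip: abs_mult)
    qed
    then have "sq_dist I x (\<lambda>_. 0) \<le> (\<Sum>i\<in>I. \<delta>)"
      unfolding sq_dist_def by (intro sum_mono) auto
    then show ?thesis using \<delta>(3) by simp
  qed
  then have "(\<Pi>\<^sub>E i\<in>I. {-\<delta>..\<delta>}) \<subseteq> origin_ball I 1"
    by (auto simp: origin_ball_def space_coord_lebesgue PiE_iff)
  then have "emeasure (coord_lebesgue I) (\<Pi>\<^sub>E i\<in>I. {-\<delta>..\<delta>}) \<le> emeasure (coord_lebesgue I) (origin_ball I 1)"
    by (intro emeasure_mono) auto
  moreover have "emeasure (coord_lebesgue I) (\<Pi>\<^sub>E i\<in>I. {-\<delta>..\<delta>}) = ennreal (2 * \<delta>) ^ card I"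
    using assms \<delta> unfolding coord_lebesgue_def by (subst reals.emeasure_PiM) auto
  moreover have "0 < ennreal (2 * \<delta>) ^ card I" using \<delta> by (simp add: ennreal_power)
  ultimately show ?thesis by (metis less_le_trans)
qed

section \<open>Smallest enclosing balls\<close>

lemma compact_cube:
  "compact {q :: nat \<Rightarrow> real. \<forall>i. q i \<in> {-b..b}}"
proof -
  have "{q :: nat \<Rightarrow> real. \<forall>i. q i \<in> {-b..b}} = (\<Pi>\<^sub>E i\<in>UNIV. {-b..b})" by (auto simp: PiE_iff)
  moreover have "compactin (product_topology (\<lambda>_::nat. euclidean :: real topology) UNIV) (\<Pi>\<^sub>E i\<in>UNIV. {-b..b})"
    by (simp add: compactin_PiE)
  ultimately show ?thesis by (simp only: euclidean_product_topology compactin_euclidean_iff)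
qed

lemma euclid_dist_sq: "(euclid_dist n x y)\<^sup>2 = (\<Sum>i<n. (x i - y i)\<^sup>2)"
  by (simp add: euclid_dist_def L2_set_def sum_nonneg)

lemma euclid_dist_nonneg [simp]: "0 \<le> euclid_dist n x y"
  by (simp add: euclid_dist_def)

lemma euclid_dist_commute: "euclid_dist n x y = euclid_dist n y x"
  by (simp add: euclid_dist_def L2_set_def power2_commute)

lemma euclid_dist_triangle: "euclid_dist n x z \<le> euclid_dist n x y + euclid_dist n y z"
  using L2_set_triangle_ineq[of "\<lambda>i. x i - y i" "\<lambda>i. y i - z i" "{..<n}"]
  by (simp add: euclid_dist_def)

lemma law_of_cosines:
  "(euclid_dist n x q)\<^sup>2 = (euclid_dist n x c)\<^sup>2 + (euclid_dist n q c)\<^sup>2 - 2 * (\<Sum>i<n. (x i - c i) * (q i - c i))"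
  unfolding euclid_dist_sq sum_distrib_left sum.distrib[symmetric] sum_subtractf[symmetric]
  by (intro sum.cong) (auto simp: power2_eq_square algebra_simps)

lemma euclid_dist_mono:
  "(\<And>i. i < n \<Longrightarrow> \<bar>x i - y i\<bar> \<le> \<bar>x' i - y' i\<bar>) \<Longrightarrow> euclid_dist n x y \<le> euclid_dist n x' y'"
  unfolding euclid_dist_def L2_set_def
  by (intro real_sqrt_le_mono sum_mono) (simp add: abs_le_square_iff)

lemma continuous_on_farthest_distance:
  assumes "finite X" "X \<noteq> {}"
  shows "continuous_on S (\<lambda>q. MAX x\<in>X. euclid_dist n x q)"
  using assms
proof (induction X rule: finite_ne_induct)
  case (singleton x)
  show ?case unfolding euclid_dist_def L2_set_def
    by (auto intro!: continuous_intros continuous_on_subset[OF continuous_on_product_coordinates])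
next
  case (insert x X)
  have "continuous_on S (euclid_dist n x)" unfolding euclid_dist_def L2_set_def
    by (auto intro!: continuous_intros continuous_on_subset[OF continuous_on_product_coordinates])
  then have "continuous_on S (\<lambda>q. max (euclid_dist n x q) (MAX x\<in>X. euclid_dist n x q))"
    using insert.IH by (intro continuous_on_max) auto
  with insert.hyps show ?case by simp
qed

text \<open>
  The minimum of the farthest distance over a cube containing \<open>X\<close> exists by compactness. It
  is a global minimum, because clipping the coordinates of a point to the cube brings the
  point closer to every point of the cube.
\<close>

lemma exists_smallest_enclosing_ball:
  assumes "finite X" "X \<noteq> {}"
  obtains c where "\<And>q. (MAX x\<in>X. euclid_dist n x c) \<le> (MAX x\<in>X. euclid_dist n x q)"
proof -
  define b where "b = (\<Sum>x\<in>X. \<Sum>i<n. \<bar>x i\<bar>)"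
  have b: "\<bar>x i\<bar> \<le> b" if "x \<in> X" "i < n" for x i
  proof -
    have "\<bar>x i\<bar> \<le> (\<Sum>i<n. \<bar>x i\<bar>)" using that by (intro member_le_sum) auto
    also have "\<dots> \<le> b" unfolding b_def
      using that assms by (intro member_le_sum[of x X "\<lambda>x. \<Sum>i<n. \<bar>x i\<bar>"]) (auto intro: sum_nonneg)
    finally show ?thesis .
  qed
  have "0 \<le> b" unfolding b_def by (intro sum_nonneg) auto
  let ?K = "{q :: nat \<Rightarrow> real. \<forall>i. q i \<in> {-b..b}}" and ?f = "\<lambda>q. MAX x\<in>X. euclid_dist n x q"
  have "(\<lambda>_. 0) \<in> ?K" using \<open>0 \<le> b\<close> by simp
  then have "?K \<noteq> {}" by (metis empty_iff)
  then have "\<exists>c\<in>?K. \<forall>q\<in>?K. ?f c \<le> ?f q"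
    by (intro continuous_attains_inf compact_cube continuous_on_farthest_distance assms)
  then obtain c where "\<forall>q\<in>?K. ?f c \<le> ?f q" ..
  note c = bspec[OF this]
  show thesis
  proof (rule that)
    fix q
    define q' :: "nat \<Rightarrow> real" where "q' = (\<lambda>i. max (-b) (min b (q i)))"
    have "euclid_dist n x q' \<le> ?f q" if "x \<in> X" for x
    proof -
      have "euclid_dist n x q' \<le> euclid_dist n x q"
      proof (rule euclid_dist_mono)
        fix i assume "i < n"
        with b[OF that] have "\<bar>x i\<bar> \<le> b" by blast
        then show "\<bar>x i - q' i\<bar> \<le> \<bar>x i - q i\<bar>" unfolding q'_def by linarith
      qed
      also have "\<dots> \<le> ?f q" using that assms by (intro Max_ge) auto
      finally show ?thesis .
    qed
    then have "?f q' \<le> ?f q" using assms by (intro Max.boundedI) auto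
    moreover have "?f c \<le> ?f q'" using \<open>0 \<le> b\<close> by (intro c) (auto simp: q'_def)
    ultimately show "?f c \<le> ?f q" by linarith
  qed
qed

text \<open>
  If all farthest points were on the side of \<open>q\<close> of the hyperplane through \<open>c\<close> orthogonal to
  \<open>q - c\<close>, moving \<open>c\<close> slightly towards \<open>q\<close> would bring all of them closer, while the other
  points would still be closer than the maximum; \<open>c\<close> would not be optimal.
\<close>

lemma circumcentre:
  assumes "finite X" "X \<noteq> {}"
  obtains c where "\<And>q. \<exists>x\<in>X. (\<forall>y\<in>X. euclid_dist n y c \<le> euclid_dist n x c) \<and>
      (\<Sum>i<n. (x i - c i) * (q i - c i)) \<le> 0"
proof -
  let ?f = "\<lambda>q. MAX x\<in>X. euclid_dist n x q"
  obtain c where c: "\<And>q. ?f c \<le> ?f q"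
    using exists_smallest_enclosing_ball[OF assms] by blast
  have le: "euclid_dist n x c \<le> ?f c" if "x \<in> X" for x
    using that assms by (intro Max_ge) auto
  have "\<exists>x\<in>X. ?f c \<le> euclid_dist n x c \<and> (\<Sum>i<n. (x i - c i) * (q i - c i)) \<le> 0" for q
  proof (rule ccontr)
    assume neg: "\<not> ?thesis"
    let ?p = "\<lambda>t i. c i + t * (q i - c i)"
    have dist_p: "(euclid_dist n x (?p t))\<^sup>2
        = (euclid_dist n x c)\<^sup>2 - t * (2 * (\<Sum>i<n. (x i - c i) * (q i - c i)) - t * (euclid_dist n q c)\<^sup>2)" for x t
    proof -
      have "(euclid_dist n (?p t) c)\<^sup>2 = t\<^sup>2 * (euclid_dist n q c)\<^sup>2"
        by (simp add: euclid_dist_sq power_mult_distrib sum_distrib_left)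
      moreover have "(\<Sum>i<n. (x i - c i) * (?p t i - c i)) = t * (\<Sum>i<n. (x i - c i) * (q i - c i))"
        by (simp add: sum_distrib_left mult_ac)
      ultimately show ?thesis
        using law_of_cosines[of n x "?p t" c] by (simp add: power2_eq_square algebra_simps)
    qed
    have "eventually (\<lambda>t. (euclid_dist n x (?p t))\<^sup>2 < (?f c)\<^sup>2) (at_right 0)" if x: "x \<in> X" for x
    proof (cases "euclid_dist n x c < ?f c")
      case True
      let ?g = "\<lambda>t. (euclid_dist n x c)\<^sup>2 - t * (2 * (\<Sum>i<n. (x i - c i) * (q i - c i)) - t * (euclid_dist n q c)\<^sup>2)"
      have "(?g \<longlongrightarrow> ?g 0) (at_right 0)" by (intro tendsto_intros)
      moreover have "?g 0 < (?f c)\<^sup>2" using True by (simp add: power_strict_mono)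
      ultimately have "eventually (\<lambda>t. ?g t < (?f c)\<^sup>2) (at_right 0)" by (rule order_tendstoD)
      then show ?thesis by (simp only: dist_p)
    next
      case False
      then have eq: "euclid_dist n x c = ?f c" using le[OF x] by simp
      let ?P = "2 * (\<Sum>i<n. (x i - c i) * (q i - c i))"
      have P: "0 < ?P" using neg x False by force
      have "((\<lambda>t. ?P - t * (euclid_dist n q c)\<^sup>2) \<longlongrightarrow> ?P - 0 * (euclid_dist n q c)\<^sup>2) (at_right 0)"
        by (intro tendsto_intros)
      then have "eventually (\<lambda>t. 0 < ?P - t * (euclid_dist n q c)\<^sup>2) (at_right 0)"
        using P by (intro order_tendstoD(1)[of _ ?P]) auto
      with eventually_at_right_less[of "0::real"] show ?thesis
        by eventually_elim (simp add: dist_p eq)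
    qed
    then have "eventually (\<lambda>t. \<forall>x\<in>X. (euclid_dist n x (?p t))\<^sup>2 < (?f c)\<^sup>2) (at_right 0)"
      using assms(1) by (simp add: eventually_ball_finite_distrib)
    then obtain t :: real where t: "\<forall>x\<in>X. (euclid_dist n x (?p t))\<^sup>2 < (?f c)\<^sup>2"
      using eventually_happens'[OF trivial_limit_at_right_real] by blast
    have "0 \<le> ?f c" using le assms euclid_dist_nonneg order_trans by (metis ex_in_conv)
    then have "\<forall>x\<in>X. euclid_dist n x (?p t) < ?f c"
      using t power2_less_imp_less by blast
    then have "?f (?p t) < ?f c" using assms by simp
    then show False using c[of "?p t"] by simp
  qed
  then show thesis using that le by (meson order_trans)
qed

text \<open>
  Let \<open>c\<close> and \<open>c'\<close> be the circumcentres of \<open>X\<close> and \<open>X'\<close>. The circumradii are at least 1, so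
  the law of cosines turns the half-space property of \<open>c\<close> into: every point \<open>q\<close> has some \<open>x\<close>
  in \<open>X\<close> with \<open>|x - q|\<^sup>2 \<ge> 1 + |q - c|\<^sup>2\<close>, and likewise for \<open>c'\<close>. Taking \<open>q = z\<close> gives \<open>|z -
  c|\<^sup>2 \<le> R\<^sup>2 - 1\<close>. Taking \<open>q = c'\<close> gives \<open>x\<close>, and taking \<open>q = x\<close> for \<open>X'\<close> gives \<open>x'\<close> with \<open>4
  * a\<^sup>2 \<ge> |x' - x|\<^sup>2 \<ge> 1 + |x - c'|\<^sup>2 \<ge> 2 + |c - c'|\<^sup>2\<close>. The sum of the three distances is
  estimated by the Cauchy--Schwarz inequality.
\<close>

lemma circumcentres_close:
  assumes "finite X" "finite X'"
    and big: "\<And>q. \<exists>x\<in>X. 1 < euclid_dist n x q" "\<And>q. \<exists>x\<in>X'. 1 < euclid_dist n x q"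
    and near: "\<And>x. x \<in> X \<Longrightarrow> euclid_dist n x z \<le> R" "\<And>x. x \<in> X' \<Longrightarrow> euclid_dist n x z' \<le> R"
    and cross: "\<And>x x'. x \<in> X \<Longrightarrow> x' \<in> X' \<Longrightarrow> euclid_dist n x x' \<le> 2 * a"
    and "1 \<le> a"
  shows "euclid_dist n z z' \<le> 2 * (R * sqrt (a\<^sup>2 + 1/2))"
proof -
  have cc: "\<exists>c. \<forall>q. \<exists>x\<in>Y. 1 + (euclid_dist n q c)\<^sup>2 \<le> (euclid_dist n x q)\<^sup>2"
    if "finite Y" and Y: "\<And>q. \<exists>x\<in>Y. 1 < euclid_dist n x q" for Y
  proof -
    have "Y \<noteq> {}" using Y by auto
    then obtain c where c: "\<And>q. \<exists>x\<in>Y. (\<forall>y\<in>Y. euclid_dist n y c \<le> euclid_dist n x c) \<and>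
      (\<Sum>i<n. (x i - c i) * (q i - c i)) \<le> 0"
      using circumcentre[OF \<open>finite Y\<close>] by blast
    have "\<exists>x\<in>Y. 1 + (euclid_dist n q c)\<^sup>2 \<le> (euclid_dist n x q)\<^sup>2" for q
    proof -
      obtain x where x: "x \<in> Y" "\<forall>y\<in>Y. euclid_dist n y c \<le> euclid_dist n x c"
        "(\<Sum>i<n. (x i - c i) * (q i - c i)) \<le> 0" using c by blast
      then have "1 \<le> euclid_dist n x c" using Y[of c] by force
      then have "1 \<le> (euclid_dist n x c)\<^sup>2" by simp
      with x show ?thesis using law_of_cosines[of n x q c] by (intro bexI[of _ x]) auto
    qed
    then show ?thesis by blast
  qed
  obtain c where c: "\<And>q. \<exists>x\<in>X. 1 + (euclid_dist n q c)\<^sup>2 \<le> (euclid_dist n x q)\<^sup>2"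
    using cc[OF assms(1) big(1)] by blast
  obtain c' where c': "\<And>q. \<exists>x\<in>X'. 1 + (euclid_dist n q c')\<^sup>2 \<le> (euclid_dist n x q)\<^sup>2"
    using cc[OF assms(2) big(2)] by blast
  have "0 \<le> R" using near(1) c[of z] euclid_dist_nonneg order_trans by blast
  have sq_le: "1 + (euclid_dist n y d)\<^sup>2 \<le> R\<^sup>2 \<Longrightarrow> euclid_dist n y d \<le> sqrt (R\<^sup>2 - 1)" for y d
    by (intro real_le_rsqrt) simp
  have zc: "euclid_dist n z c \<le> sqrt (R\<^sup>2 - 1)"
  proof -
    obtain x where "x \<in> X" "1 + (euclid_dist n z c)\<^sup>2 \<le> (euclid_dist n x z)\<^sup>2" using c by blast
    moreover have "(euclid_dist n x z)\<^sup>2 \<le> R\<^sup>2" using near(1) \<open>x \<in> X\<close> by (intro power_mono) auto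
    ultimately show ?thesis by (intro sq_le) linarith
  qed
  have zc': "euclid_dist n z' c' \<le> sqrt (R\<^sup>2 - 1)"
  proof -
    obtain x where "x \<in> X'" "1 + (euclid_dist n z' c')\<^sup>2 \<le> (euclid_dist n x z')\<^sup>2" using c' by blast
    moreover have "(euclid_dist n x z')\<^sup>2 \<le> R\<^sup>2" using near(2) \<open>x \<in> X'\<close> by (intro power_mono) auto
    ultimately show ?thesis by (intro sq_le) linarith
  qed
  have "R\<^sup>2 \<ge> 1"
  proof -
    obtain x where "x \<in> X" "1 + (euclid_dist n z c)\<^sup>2 \<le> (euclid_dist n x z)\<^sup>2" using c by blast
    moreover have "(euclid_dist n x z)\<^sup>2 \<le> R\<^sup>2" using near(1) \<open>x \<in> X\<close> by (intro power_mono) auto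
    ultimately show ?thesis using zero_le_power2[of "euclid_dist n z c"] by linarith
  qed
  have cc': "euclid_dist n c c' \<le> 2 * sqrt (a\<^sup>2 - 1/2)"
  proof -
    obtain x where x: "x \<in> X" "1 + (euclid_dist n c' c)\<^sup>2 \<le> (euclid_dist n x c')\<^sup>2" using c by blast
    obtain x' where x': "x' \<in> X'" "1 + (euclid_dist n x c')\<^sup>2 \<le> (euclid_dist n x' x)\<^sup>2" using c' by blast
    have "(euclid_dist n x' x)\<^sup>2 \<le> (2 * a)\<^sup>2"
      using cross[OF x(1) x'(1)] by (intro power_mono) (auto simp: euclid_dist_commute)
    with x x' have "(euclid_dist n c c')\<^sup>2 \<le> 4 * (a\<^sup>2 - 1/2)"
      by (simp add: euclid_dist_commute power_mult_distrib)
    then have "euclid_dist n c c' \<le> sqrt (4 * (a\<^sup>2 - 1/2))" by (intro real_le_rsqrt)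
    also have "\<dots> = 2 * sqrt (a\<^sup>2 - 1/2)" by (subst real_sqrt_mult) simp
    finally show ?thesis .
  qed
  have "a\<^sup>2 \<ge> 1" using assms by simp
  define u v where "u = R\<^sup>2 - 1" and "v = a\<^sup>2 - 1/2"
  have uv: "0 \<le> u" "0 \<le> v" using \<open>R\<^sup>2 \<ge> 1\<close> \<open>a\<^sup>2 \<ge> 1\<close> by (auto simp: u_def v_def)
  have "euclid_dist n z z' \<le> 2 * (sqrt u + sqrt v)"
    using zc zc' cc' euclid_dist_triangle[of n z z' c] euclid_dist_triangle[of n c z' c']
      euclid_dist_commute[of n c' z'] by (simp add: u_def v_def)
  also have "sqrt u + sqrt v \<le> sqrt ((u + 1) * (v + 1))"
  proof (rule real_le_rsqrt)
    have "(p + q)\<^sup>2 + (p * q - 1)\<^sup>2 = (p\<^sup>2 + 1) * (q\<^sup>2 + 1)" for p q :: real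
      by (simp add: power2_eq_square algebra_simps)
    from this[of "sqrt u" "sqrt v"] show "(sqrt u + sqrt v)\<^sup>2 \<le> (u + 1) * (v + 1)"
      using uv zero_le_power2[of "sqrt u * sqrt v - 1"] by (simp only: real_sqrt_pow2)
  qed
  also have "sqrt ((u + 1) * (v + 1)) = R * sqrt (a\<^sup>2 + 1/2)"
    using \<open>0 \<le> R\<close> by (simp add: u_def v_def real_sqrt_mult)
  finally show ?thesis by simp
qed

section \<open>Concentration of points in a unit ball\<close>

lemma sum_emeasure_le_multiplicity:
  assumes "finite A" and Z: "\<And>x. x \<in> A \<Longrightarrow> Z x \<in> sets M"
    and mult: "\<And>z. card {x \<in> A. z \<in> Z x} \<le> D"
  shows "(\<Sum>x\<in>A. emeasure M (Z x)) \<le> of_nat D * emeasure M (\<Union>x\<in>A. Z x)"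
proof -
  have "(\<Sum>x\<in>A. emeasure M (Z x)) = (\<integral>\<^sup>+z. (\<Sum>x\<in>A. indicator (Z x) z) \<partial>M)"
    using Z by (subst nn_integral_sum) auto
  also have "\<dots> \<le> (\<integral>\<^sup>+z. of_nat D * indicator (\<Union>x\<in>A. Z x) z \<partial>M)"
  proof (rule nn_integral_mono)
    fix z
    have "(\<Sum>x\<in>A. indicator (Z x) z :: ennreal) = of_nat (card {x \<in> A. z \<in> Z x})"
      using assms(1) by (simp add: indicator_def sum.If_cases Int_def)
    also have "\<dots> \<le> of_nat D * indicator (\<Union>x\<in>A. Z x) z"
    proof (cases "z \<in> (\<Union>x\<in>A. Z x)")
      case True
      then show ?thesis using mult[of z] by simp
    next
      case False
      then have "{x \<in> A. z \<in> Z x} = {}" by auto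
      then show ?thesis by (simp only: card.empty of_nat_0 zero_le)
    qed
    finally show "(\<Sum>x\<in>A. indicator (Z x) z :: ennreal) \<le> of_nat D * indicator (\<Union>x\<in>A. Z x) z" .
  qed
  also have "\<dots> = of_nat D * emeasure M (\<Union>x\<in>A. Z x)"
    using assms by (intro nn_integral_cmult_indicator) auto
  finally show ?thesis .
qed

lemma sq_dist_eq: "sq_dist {..<n} x y = (euclid_dist n x y)\<^sup>2"
  by (simp add: euclid_dist_sq sq_dist_def)

lemma isodiametric_euclid:
  assumes "0 < h" "Y \<in> sets (coord_lebesgue {..<n})"
    and "\<And>x y. x \<in> Y \<Longrightarrow> y \<in> Y \<Longrightarrow> euclid_dist n x y \<le> 2 * h"
  shows "emeasure (coord_lebesgue {..<n}) Y
    \<le> ennreal (h ^ n) * emeasure (coord_lebesgue {..<n}) (origin_ball {..<n} 1)"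
proof -
  have "emeasure (coord_lebesgue {..<n}) Y \<le> emeasure (coord_lebesgue {..<n}) (origin_ball {..<n} h)"
    unfolding origin_ball_def
    by (rule isodiametric) (use assms in \<open>auto simp only: sq_dist_eq intro!: power_mono euclid_dist_nonneg\<close>)
  also have "\<dots> = ennreal (h ^ n) * emeasure (coord_lebesgue {..<n}) (origin_ball {..<n} 1)"
    using emeasure_origin_ball[of "{..<n}" h] assms by simp
  finally show ?thesis .
qed

lemma origin_ball_1: "v \<in> origin_ball {..<n} 1 \<longleftrightarrow> v \<in> extensional {..<n} \<and> euclid_dist n v (\<lambda>_. 0) \<le> 1"
  by (simp add: origin_ball_def sq_dist_eq space_coord_lebesgue abs_square_le_1)

text \<open>
  The balls whose points are counted all pass through \<open>x\<close>; for fixed \<open>v\<close> they touch each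
  other there and increase with \<open>s\<close>.
\<close>

definition through_count :: "nat \<Rightarrow> (nat \<Rightarrow> real) set \<Rightarrow> real \<Rightarrow> (nat \<Rightarrow> real) \<Rightarrow> (nat \<Rightarrow> real) \<Rightarrow> nat"
  where "through_count n A s x v =
    card {y \<in> A. euclid_dist n y (\<lambda>i. x i + s * v i) \<le> s * euclid_dist n v (\<lambda>_. 0)}"

lemma measurable_through_count:
  assumes "finite A"
  shows "(\<lambda>v. real (through_count n A s x v)) \<in> borel_measurable (coord_lebesgue {..<n})"
proof -
  have [measurable]: "(\<lambda>v. euclid_dist n y (\<lambda>i. x i + s * v i)) \<in> borel_measurable (coord_lebesgue {..<n})"
    "(\<lambda>v. euclid_dist n v (\<lambda>_. 0)) \<in> borel_measurable (coord_lebesgue {..<n})" for y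
    unfolding euclid_dist_def L2_set_def by measurable
  have "(\<lambda>v. \<Sum>y\<in>A. if euclid_dist n y (\<lambda>i. x i + s * v i) \<le> s * euclid_dist n v (\<lambda>_. 0) then 1 else 0 :: real)
    \<in> borel_measurable (coord_lebesgue {..<n})"
    by measurable
  then show ?thesis
    using assms by (simp add: through_count_def sum.If_cases Int_def)
qed

lemma euclid_dist_rescale:
  assumes "0 < s"
  shows "euclid_dist n y (\<lambda>i. x i + s * rescale {..<n} x s z i) = euclid_dist n y z"
    and "s * euclid_dist n (rescale {..<n} x s z) (\<lambda>_. 0) = euclid_dist n z x"
proof -
  show "euclid_dist n y (\<lambda>i. x i + s * rescale {..<n} x s z i) = euclid_dist n y z"
    unfolding euclid_dist_def rescale_def by (rule L2_set_cong) (use assms in auto)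
  have "s * euclid_dist n (rescale {..<n} x s z) (\<lambda>_. 0)
      = L2_set (\<lambda>i. s * (rescale {..<n} x s z i - 0)) {..<n}"
    unfolding euclid_dist_def using assms by (intro L2_set_right_distrib) auto
  also have "\<dots> = euclid_dist n z x"
    unfolding euclid_dist_def rescale_def by (rule L2_set_cong) (use assms in auto)
  finally show "s * euclid_dist n (rescale {..<n} x s z) (\<lambda>_. 0) = euclid_dist n z x" .
qed

lemma euclid_dist_along:
  "euclid_dist n (\<lambda>i. x i + s * v i) (\<lambda>i. x i + t * v i) = \<bar>s - t\<bar> * euclid_dist n v (\<lambda>_. 0)"
proof -
  have "\<bar>s - t\<bar> * euclid_dist n v (\<lambda>_. 0) = L2_set (\<lambda>i. \<bar>s - t\<bar> * (v i - 0)) {..<n}"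
    unfolding euclid_dist_def by (intro L2_set_right_distrib) auto
  also have "\<dots> = euclid_dist n (\<lambda>i. x i + s * v i) (\<lambda>i. x i + t * v i)"
    unfolding euclid_dist_def L2_set_def
    by (intro arg_cong[where f=sqrt] sum.cong) (auto simp: power_mult_distrib simp flip: left_diff_distrib)
  finally show ?thesis by simp
qed

lemma finite_attains_max:
  fixes f :: "'a \<Rightarrow> 'b::linorder"
  assumes "finite S" "S \<noteq> {}"
  shows "\<exists>x\<in>S. \<forall>y\<in>S. f y \<le> f x"
proof -
  have "Max (f ` S) \<in> f ` S" using assms by simp
  then obtain x where "Max (f ` S) = f x" "x \<in> S" by (rule imageE)
  moreover have "f y \<le> Max (f ` S)" if "y \<in> S" for y using that assms by simp
  ultimately show ?thesis by auto
qed

text \<open>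
  Let \<open>x\<close> be the point of the set that is farthest from \<open>z\<close>. Then the whole set is in the
  ball through \<open>x\<close> around \<open>z\<close>, whose points are counted by \<open>through_count n A s x v\<close> with \<open>z
  = x + s v\<close>.
\<close>

lemma tangent_pieces_multiplicity:
  assumes "finite A" "0 < s" and V: "\<And>x v. v \<in> V x \<Longrightarrow> through_count n A s x v \<le> D"
  shows "card {x \<in> A. rescale {..<n} x s z \<in> V x} \<le> D"
proof (cases "{x \<in> A. rescale {..<n} x s z \<in> V x} = {}")
  case False
  let ?S = "{x \<in> A. rescale {..<n} x s z \<in> V x}"
  have "finite ?S" using assms(1) by simp
  then have "\<exists>x\<in>?S. \<forall>y\<in>?S. euclid_dist n z y \<le> euclid_dist n z x"
    using False by (rule finite_attains_max)
  then obtain x where x: "x \<in> ?S" "\<forall>y\<in>?S. euclid_dist n z y \<le> euclid_dist n z x" ..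
  have "card ?S \<le> card {y \<in> A. euclid_dist n y z \<le> euclid_dist n z x}"
    using assms(1) x(2) by (intro card_mono) (auto simp: euclid_dist_commute)
  also have "\<dots> = through_count n A s x (rescale {..<n} x s z)"
    using assms(2) by (simp add: through_count_def euclid_dist_rescale)
  also have "\<dots> \<le> D" using V x(1) by blast
  finally show ?thesis .
qed (simp only: card.empty zero_le)

text \<open>
  The set \<open>V k x\<close> collects the vectors \<open>v\<close> for which the ball through \<open>x\<close> with centre \<open>x + s
  k v\<close> is the last in the chain to hold at most \<open>D\<close> points of \<open>A\<close>. The chain stops at the
  index \<open>K\<close>, where \<open>s K \<ge> a n\<close>: from there on the enlarged pieces are so large that the
  crude estimate \<open>2 * (s K + a)\<close> of the diameter of their union, by the triangle inequality,
  costs only a constant factor.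
\<close>

theorem card_le_unit_ball_count:
  assumes A: "finite A" and "1 \<le> n" "1 \<le> a" "a \<le> 4"
    and diam: "\<And>x y. x \<in> A \<Longrightarrow> y \<in> A \<Longrightarrow> euclid_dist n x y \<le> 2 * a"
    and D: "\<And>q. card {x \<in> A. euclid_dist n x q \<le> 1} \<le> D"
  shows "real (card A) \<le> 9 * (4 * real n ^ 2 + 1) * sqrt (a\<^sup>2 + 1/2) ^ n * real D"
proof -
  define K where "K = 4 * n\<^sup>2"
  define s where "s k = (1 + 1 / real n) ^ k" for k
  let ?L = "coord_lebesgue {..<n}" and ?B = "origin_ball {..<n} 1"
  define w where "w = emeasure ?L ?B"
  have s_ge_1: "1 \<le> s k" for k unfolding s_def by (intro one_le_power) simp
  then have s_pos: "0 < s k" for k using less_le_trans zero_less_one by blast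
  have s_Suc: "s (Suc k) = s k * (1 + 1 / real n)" for k by (simp add: s_def)
  define V where "V k x = {v \<in> ?B. through_count n A (s k) x v \<le> D \<and>
     (k < K \<longrightarrow> D < through_count n A (s (Suc k)) x v)}" for k x
  have V_sets: "V k x \<in> sets ?L" for k x
  proof -
    note [measurable] = measurable_through_count[OF A]
    have "V k x = {v \<in> space ?L. v \<in> ?B \<and> real (through_count n A (s k) x v) \<le> real D \<and>
     (k < K \<longrightarrow> real D < real (through_count n A (s (Suc k)) x v))}"
      by (auto simp: V_def origin_ball_def)
    also have "\<dots> \<in> sets ?L" by measurable
    finally show ?thesis .
  qed
  \<comment> \<open>For \<open>k = 0\<close> the ball lies in a unit ball, so its count is at most \<open>D\<close>; a first excess occurs later or not at all.\<close>
  have cover: "\<exists>k\<le>K. v \<in> V k x" if v: "v \<in> ?B" for v x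
  proof (cases "through_count n A (s K) x v \<le> D")
    case True
    then show ?thesis using v by (intro exI[of _ K]) (auto simp: V_def)
  next
    case False
    have "{y \<in> A. euclid_dist n y (\<lambda>i. x i + s 0 * v i) \<le> s 0 * euclid_dist n v (\<lambda>_. 0)}
        \<subseteq> {y \<in> A. euclid_dist n y (\<lambda>i. x i + s 0 * v i) \<le> 1}"
      using v by (auto simp: s_def origin_ball_1)
    then have "through_count n A (s 0) x v \<le> card {y \<in> A. euclid_dist n y (\<lambda>i. x i + s 0 * v i) \<le> 1}"
      unfolding through_count_def using A by (intro card_mono) auto
    also have "\<dots> \<le> D" by (rule D)
    finally have "through_count n A (s 0) x v \<le> D" .
    with False obtain k where "k < K" "through_count n A (s k) x v \<le> D" "\<not> through_count n A (s (Suc k)) x v \<le> D"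
      using inc_induct[of 0 K "\<lambda>k. \<not> through_count n A (s k) x v \<le> D"] by (meson zero_le)
    then show ?thesis using v by (intro exI[of _ k]) (auto simp: V_def)
  qed
  have "of_nat (card A) * w = (\<Sum>x\<in>A. emeasure ?L ?B)" by (simp add: w_def)
  also have "\<dots> \<le> (\<Sum>x\<in>A. \<Sum>k\<le>K. emeasure ?L (V k x))"
  proof (rule sum_mono)
    fix x
    have "?B \<subseteq> (\<Union>k\<le>K. V k x)" using cover by fastforce
    then have "emeasure ?L ?B \<le> emeasure ?L (\<Union>k\<le>K. V k x)"
      using V_sets by (intro emeasure_mono) auto
    also have "\<dots> \<le> (\<Sum>k\<le>K. emeasure ?L (V k x))"
      using V_sets by (intro emeasure_subadditive_finite) auto
    finally show "emeasure ?L ?B \<le> (\<Sum>k\<le>K. emeasure ?L (V k x))" .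
  qed
  also have "\<dots> = (\<Sum>k\<le>K. \<Sum>x\<in>A. emeasure ?L (V k x))" by (rule sum.swap)
  finally have total: "of_nat (card A) * w \<le> (\<Sum>k\<le>K. \<Sum>x\<in>A. emeasure ?L (V k x))" .
  let ?T = "\<lambda>k. \<Sum>x\<in>A. emeasure ?L (V k x)"
  obtain k where k: "k \<le> K" "\<And>j. j \<le> K \<Longrightarrow> ?T j \<le> ?T k"
  proof -
    have "\<exists>k\<in>{..K}. \<forall>j\<in>{..K}. ?T j \<le> ?T k" by (rule finite_attains_max) auto
    then show thesis using that by auto
  qed
  have "(\<Sum>k\<le>K. ?T k) \<le> of_nat (card {..K}) * ?T k"
    using k(2) by (intro sum_bounded_above) auto
  with total have pigeon: "of_nat (card A) * w \<le> of_nat (K + 1) * ?T k" by simp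
  define Z where "Z x = {z \<in> space ?L. rescale {..<n} x (s k) z \<in> V k x}" for x
  have Z_sets: "Z x \<in> sets ?L" for x
  proof -
    have "rescale {..<n} x (s k) -` V k x \<inter> space ?L \<in> sets ?L"
      using V_sets by (intro measurable_sets[OF measurable_rescale])
    then show ?thesis by (simp add: Z_def vimage_def Int_def conj_commute)
  qed
  define Y where "Y = (\<Union>x\<in>A. Z x)"
  have Y_sets: "Y \<in> sets ?L" unfolding Y_def using A Z_sets by auto
  have "ennreal (s k ^ n) * ?T k = (\<Sum>x\<in>A. emeasure ?L (Z x))"
    unfolding Z_def sum_distrib_left using emeasure_rescale_preimage[OF finite_lessThan s_pos V_sets]
    by (intro sum.cong) auto
  also have "\<dots> \<le> of_nat D * emeasure ?L Y"
    unfolding Y_def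
  proof (rule sum_emeasure_le_multiplicity[OF A Z_sets])
    fix z
    have "card {x \<in> A. z \<in> Z x} \<le> card {x \<in> A. rescale {..<n} x (s k) z \<in> V k x}"
      using A by (intro card_mono) (auto simp: Z_def)
    also have "\<dots> \<le> D"
      by (rule tangent_pieces_multiplicity[OF A s_pos]) (auto simp: V_def)
    finally show "card {x \<in> A. z \<in> Z x} \<le> D" .
  qed
  finally have vol_V: "ennreal (s k ^ n) * ?T k \<le> of_nat D * emeasure ?L Y" .
  have Z_dest: "\<exists>v. euclid_dist n v (\<lambda>_. 0) \<le> 1 \<and> v \<in> V k x \<and> (\<forall>y. euclid_dist n y (\<lambda>i. x i + s k * v i) = euclid_dist n y z)
      \<and> s k * euclid_dist n v (\<lambda>_. 0) = euclid_dist n z x" if "z \<in> Z x" for z x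
  proof (intro exI[of _ "rescale {..<n} x (s k) z"] conjI allI)
    show v: "rescale {..<n} x (s k) z \<in> V k x" using that by (simp add: Z_def)
    then show "euclid_dist n (rescale {..<n} x (s k) z) (\<lambda>_. 0) \<le> 1"
      by (simp add: V_def origin_ball_1)
  qed (rule euclid_dist_rescale[OF s_pos])+
  let ?g = "sqrt (a\<^sup>2 + 1/2)"
  have g: "1 \<le> ?g" using assms(3) by (intro real_le_rsqrt) (simp add: add_increasing2)
  \<comment> \<open>The diameter of \<open>Y\<close> is at most \<open>2 * h\<close>, where the excess of \<open>h\<close> over \<open>s k * ?g\<close> is a factor
    \<open>1 + 2/n\<close> at most, whose \<open>n\<close>-th power is at most \<open>exp 2 \<le> 9\<close>.\<close>
  obtain h where h: "0 < h" "h ^ n \<le> s k ^ n * (9 * ?g ^ n)"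
    and Y_diam: "\<And>z z'. z \<in> Y \<Longrightarrow> z' \<in> Y \<Longrightarrow> euclid_dist n z z' \<le> 2 * h"
  proof (cases "k < K")
    case True
    define R where "R = s k * (1 + 2 / real n)"
    \<comment> \<open>The next ball in the chain holds more than \<open>D\<close> points, so they fit in no unit ball, and it
      is contained in a ball of radius \<open>R\<close> around \<open>z\<close>.\<close>
    have crowd: "\<exists>X. X \<subseteq> A \<and> (\<forall>q. \<exists>x\<in>X. 1 < euclid_dist n x q) \<and> (\<forall>x\<in>X. euclid_dist n x z \<le> R)"
      if z: "z \<in> Y" for z
    proof -
      obtain x where "z \<in> Z x" using z by (auto simp: Y_def)
      then obtain v where v: "euclid_dist n v (\<lambda>_. 0) \<le> 1" "v \<in> V k x"
        "\<And>y. euclid_dist n y (\<lambda>i. x i + s k * v i) = euclid_dist n y z" using Z_dest by blast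
      let ?c = "\<lambda>i. x i + s (Suc k) * v i"
      let ?X = "{y \<in> A. euclid_dist n y ?c \<le> s (Suc k) * euclid_dist n v (\<lambda>_. 0)}"
      have "\<exists>y\<in>?X. 1 < euclid_dist n y q" for q
      proof (rule ccontr)
        assume "\<not> ?thesis"
        then have "?X \<subseteq> {y \<in> A. euclid_dist n y q \<le> 1}" by force
        then have "card ?X \<le> card {y \<in> A. euclid_dist n y q \<le> 1}" using A by (intro card_mono) auto
        then have "through_count n A (s (Suc k)) x v \<le> D" unfolding through_count_def using D[of q] by linarith
        then show False using v(2) True by (auto simp: V_def)
      qed
      moreover have "euclid_dist n y z \<le> R" if "y \<in> ?X" for y
      proof -
        have "euclid_dist n y z \<le> euclid_dist n y ?c + euclid_dist n ?c z" by (rule euclid_dist_triangle)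
        also have "euclid_dist n ?c z = \<bar>s (Suc k) - s k\<bar> * euclid_dist n v (\<lambda>_. 0)"
          unfolding v(3)[symmetric] by (rule euclid_dist_along)
        also have "\<bar>s (Suc k) - s k\<bar> = s k / real n"
          using s_pos[of k] by (simp add: s_Suc algebra_simps)
        also have "euclid_dist n y ?c \<le> s (Suc k) * euclid_dist n v (\<lambda>_. 0)" using that by simp
        also have "s (Suc k) * euclid_dist n v (\<lambda>_. 0) + s k / real n * euclid_dist n v (\<lambda>_. 0)
           = R * euclid_dist n v (\<lambda>_. 0)" by (simp add: R_def s_Suc algebra_simps)
        also have "\<dots> \<le> R * 1" using v(1) s_pos[of k] by (intro mult_left_mono) (auto simp: R_def)
        finally show ?thesis by simp
      qed
      ultimately show ?thesis by (intro exI[of _ ?X] conjI allI ballI) (assumption | rule Collect_restrict)+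
    qed
    show thesis
    proof (rule that)
      show "0 < R * ?g" using s_pos[of k] g by (auto simp: R_def intro!: mult_pos_pos add_pos_nonneg)
      have "(1 + 2 / real n) ^ n \<le> exp 2"
        using assms(2) exp_ge_one_plus_x_over_n_power_n[of n 2] by simp
      also have "\<dots> = exp 1 * exp (1::real)" by (simp flip: exp_add)
      also have "\<dots> \<le> 3 * 3" using exp_le by (intro mult_mono) auto
      finally show "(R * ?g) ^ n \<le> s k ^ n * (9 * ?g ^ n)"
        using s_pos[of k] g by (simp add: R_def power_mult_distrib mult.assoc mult_left_mono mult_right_mono)
      show "euclid_dist n z z' \<le> 2 * (R * ?g)" if zz': "z \<in> Y" "z' \<in> Y" for z z'
      proof -
        obtain X where X: "X \<subseteq> A" "\<And>q. \<exists>x\<in>X. 1 < euclid_dist n x q" "\<And>x. x \<in> X \<Longrightarrow> euclid_dist n x z \<le> R"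
          using crowd[OF zz'(1)] by blast
        obtain X' where X': "X' \<subseteq> A" "\<And>q. \<exists>x\<in>X'. 1 < euclid_dist n x q" "\<And>x. x \<in> X' \<Longrightarrow> euclid_dist n x z' \<le> R"
          using crowd[OF zz'(2)] by blast
        show ?thesis
          by (rule circumcentres_close[OF _ _ X(2) X'(2) X(3) X'(3) _ assms(3)])
             (use X(1) X'(1) A diam finite_subset in \<open>blast+\<close>)
      qed
    qed
  next
    case False
    then have k: "k = K" using k(1) by simp
    have "1 + real K * (1 / real n) \<le> s K"
      unfolding s_def by (rule Bernoulli_inequality) (rule order.trans[of _ 0], simp_all)
    moreover have "real K * (1 / real n) = 4 * real n"
      using assms(2) by (simp add: K_def power2_eq_square)
    ultimately have sK: "a * real n \<le> s K" using assms(4) mult_right_mono[of a 4 "real n"] by linarith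
    show thesis
    proof (rule that)
      show "0 < s k + a" using s_pos[of k] assms by linarith
      have "s k + a \<le> s k * (1 + 1 / real n)"
        using sK assms(2) k by (simp add: field_simps)
      then have "(s k + a) ^ n \<le> s k ^ n * (1 + 1 / real n) ^ n"
        using s_pos[of k] assms by (simp flip: power_mult_distrib add: power_mono)
      also have "(1 + 1 / real n) ^ n \<le> exp 1"
        using assms(2) exp_ge_one_plus_x_over_n_power_n[of n 1] by simp
      also have "exp 1 \<le> (9 :: real)" using exp_le by simp
      also have "9 \<le> 9 * ?g ^ n" using g by simp
      finally show "(s k + a) ^ n \<le> s k ^ n * (9 * ?g ^ n)"
        using s_pos[of k] by (simp add: mult_left_mono)
      show "euclid_dist n z z' \<le> 2 * (s k + a)" if zz': "z \<in> Y" "z' \<in> Y" for z z'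
      proof -
        have near: "\<exists>x\<in>A. euclid_dist n z x \<le> s k" if z: "z \<in> Y" for z
        proof -
          obtain x where x: "x \<in> A" "z \<in> Z x" using z by (auto simp: Y_def)
          obtain v where "euclid_dist n v (\<lambda>_. 0) \<le> 1" "s k * euclid_dist n v (\<lambda>_. 0) = euclid_dist n z x"
            using Z_dest[OF x(2)] by blast
          moreover from this have "s k * euclid_dist n v (\<lambda>_. 0) \<le> s k * 1" using s_pos[of k] by (intro mult_left_mono) auto
          ultimately show ?thesis using x by auto
        qed
        obtain x x' where "x \<in> A" "x' \<in> A" "euclid_dist n z x \<le> s k" "euclid_dist n z' x' \<le> s k"
          using near[OF zz'(1)] near[OF zz'(2)] by blast
        with diam[of x x'] euclid_dist_triangle[of n z z' x] euclid_dist_triangle[of n x z' x'] euclid_dist_commute[of n z' x']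
        show ?thesis by simp
      qed
    qed
  qed
  have w: "0 < w" "w < \<infinity>"
    unfolding w_def by (auto intro: emeasure_unit_ball_pos simp: emeasure_unit_ball_finite[simplified])
  have "ennreal (s k ^ n * real (card A)) * w = ennreal (s k ^ n) * (of_nat (card A) * w)"
    using s_pos[of k] by (simp add: ennreal_mult ennreal_of_nat_eq_real_of_nat mult_ac)
  also have "\<dots> \<le> ennreal (s k ^ n) * (of_nat (K + 1) * ?T k)"
    using pigeon by (rule mult_left_mono) simp
  also have "\<dots> = of_nat (K + 1) * (ennreal (s k ^ n) * ?T k)" by (simp only: mult_ac)
  also have "\<dots> \<le> of_nat (K + 1) * (of_nat D * (ennreal (h ^ n) * w))"
    using vol_V isodiametric_euclid[OF h(1) Y_sets Y_diam] unfolding w_def[symmetric]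
    by (meson mult_left_mono order_trans zero_le)
  also have "\<dots> = ennreal (real (K + 1) * real D * h ^ n) * w"
    using h(1) by (simp add: ennreal_mult ennreal_of_nat_eq_real_of_nat mult_ac del: of_nat_add)
  finally have "ennreal (s k ^ n * real (card A)) \<le> ennreal (real (K + 1) * real D * h ^ n)"
    using w by (metis ennreal_mult_le_mult_iff infinity_ennreal_def less_irrefl mult.commute)
  then have "s k ^ n * real (card A) \<le> real (K + 1) * real D * h ^ n"
    using h(1) by (subst (asm) ennreal_le_iff) auto
  also have "\<dots> \<le> real (K + 1) * real D * (s k ^ n * (9 * ?g ^ n))"
    using h(2) by (intro mult_left_mono) auto
  finally have "s k ^ n * real (card A) \<le> s k ^ n * (real (K + 1) * real D * (9 * ?g ^ n))"
    by (simp only: mult_ac)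
  then have "real (card A) \<le> real (K + 1) * real D * (9 * ?g ^ n)"
    using s_pos[of k] by (simp only: mult_le_cancel_left_pos zero_less_power)
  then show ?thesis by (simp add: K_def algebra_simps)
qed

section \<open>Covering by balls of equal radius\<close>

lemma euclid_dist_divide:
  assumes "0 < u"
  shows "euclid_dist n (\<lambda>i. x i / u) (\<lambda>i. y i / u) = euclid_dist n x y / u"
proof -
  have "euclid_dist n x y / u = L2_set (\<lambda>i. (1 / u) * (x i - y i)) {..<n}"
    using assms L2_set_right_distrib[of "1 / u" "\<lambda>i. x i - y i" "{..<n}"] by (simp add: euclid_dist_def)
  also have "\<dots> = euclid_dist n (\<lambda>i. x i / u) (\<lambda>i. y i / u)"
    unfolding euclid_dist_def by (simp add: diff_divide_distrib)
  finally show ?thesis by simp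
qed

text \<open>
  The constant is \<open>9 * 3 ^ 5\<close>: the factor 9 of \<open>card_le_unit_ball_count\<close> and the bound \<open>exp
  5 \<le> 3 ^ 5\<close> for replacing \<open>a\<^sup>2 + 1/2\<close> by \<open>3/2\<close> when \<open>a\<close> is close to 1.
\<close>

definition clustering_bound :: "nat \<Rightarrow> real"
  where "clustering_bound n = 2187 * (4 * real n ^ 2 + 1) * sqrt (3/2) ^ n"

text \<open>
  With \<open>a = 1 + O(1/n)\<close> the base exceeds \<open>sqrt (3/2)\<close> by a factor \<open>1 + 5/n\<close> at most, whose
  \<open>n\<close>-th power is at most \<open>exp 5 \<le> 3 ^ 5\<close>.
\<close>

lemma sqrt_power_le:
  assumes "1 \<le> n" and a: "0 \<le> a" "a \<le> 1 + 3 / real n"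
  shows "sqrt (a\<^sup>2 + 1/2) ^ n \<le> 243 * sqrt (3/2) ^ n"
proof -
  have "3 / real n \<le> 3" using assms(1) by (simp add: field_simps)
  then have "3 / real n * (3 / real n) \<le> 3 * (3 / real n)" by (rule mult_right_mono) simp
  then have "(1 + 3 / real n)\<^sup>2 \<le> 1 + 15 / real n"
    by (simp add: power2_eq_square algebra_simps)
  moreover have "a\<^sup>2 \<le> (1 + 3 / real n)\<^sup>2" using a by (intro power_mono)
  ultimately have "a\<^sup>2 + 1/2 \<le> 3/2 * (1 + 10 / real n)" by simp
  also have "1 + 10 / real n \<le> (1 + 5 / real n)\<^sup>2" by (simp add: power2_eq_square algebra_simps)
  finally have "sqrt (a\<^sup>2 + 1/2) \<le> sqrt (3/2 * (1 + 5 / real n)\<^sup>2)" by (simp add: mult_left_mono)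
  then have "sqrt (a\<^sup>2 + 1/2) \<le> sqrt (3/2) * (1 + 5 / real n)"
    by (simp only: real_sqrt_mult) (simp add: add_nonneg_nonneg)
  then have "sqrt (a\<^sup>2 + 1/2) ^ n \<le> sqrt (3/2) ^ n * (1 + 5 / real n) ^ n"
    unfolding power_mult_distrib[symmetric] by (intro power_mono) auto
  also have "(1 + 5 / real n) ^ n \<le> exp 5"
    using assms(1) exp_ge_one_plus_x_over_n_power_n[of n 5] by simp
  also have "exp (5::real) = exp 1 ^ 5" by (simp flip: exp_of_nat_mult)
  also have "exp 1 ^ 5 \<le> (3::real) ^ 5" using exp_le by (intro power_mono) auto
  finally show ?thesis by (simp add: mult_left_mono mult_ac)
qed

text \<open>
  The result for unit balls, scaled by \<open>u = \<rho> * (1 - 1/(2n))\<close> and applied with \<open>D\<close> the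
  largest number of points that a ball of radius \<open>u\<close> holds. The radius is slightly less than
  \<open>\<rho>\<close> to leave room for passing to a net. The ratio \<open>a\<close> stays at most 4 even for \<open>n = 1\<close>.
\<close>

lemma exists_crowded_ball:
  assumes A: "finite A" and n: "1 \<le> n" and "0 < \<rho>"
    and diam: "\<And>x y. x \<in> A \<Longrightarrow> y \<in> A \<Longrightarrow> euclid_dist n x y \<le> 2 * \<rho> * (1 + 1 / real n)"
  shows "\<exists>q. real (card A) \<le> clustering_bound n *
    real (card {x \<in> A. euclid_dist n x q \<le> \<rho> * (1 - 1 / (2 * real n))})"
proof -
  define u where "u = \<rho> * (1 - 1 / (2 * real n))"
  define a where "a = (1 + 1 / real n) / (1 - 1 / (2 * real n))"
  let ?N = "\<lambda>q. {x \<in> A. euclid_dist n x q \<le> u}"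
  have half: "1 / 2 \<le> 1 - 1 / (2 * real n)" using n by (simp add: field_simps)
  have "0 < u" using assms half by (simp add: u_def)
  have a: "1 \<le> a" "a \<le> 4" "a \<le> 1 + 3 / real n" and ua: "\<rho> * (1 + 1 / real n) = u * a"
    using n half by (auto simp: a_def u_def field_simps)
  have diam': "euclid_dist n x y \<le> 2 * a * u" if "x \<in> A" "y \<in> A" for x y
    using diam[OF that] ua by (simp only: mult.assoc mult.commute[of a u])
  have "\<forall>q. card (?N q) < Suc (card A)"
    using A by (auto intro: card_mono simp: less_Suc_eq_le)
  then obtain q where q: "\<And>p. card (?N p) \<le> card (?N q)"
    using ex_has_greatest_nat[of "\<lambda>_. True" undefined "\<lambda>q. card (?N q)" "Suc (card A)"] by blast
  define f where "f x = (\<lambda>i. x i / u)" for x :: "nat \<Rightarrow> real"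
  have inj: "inj_on f B" for B
    using \<open>0 < u\<close> by (auto simp: inj_on_def f_def fun_eq_iff)
  have "real (card (f ` A)) \<le> 9 * (4 * real n ^ 2 + 1) * sqrt (a\<^sup>2 + 1/2) ^ n * real (card (?N q))"
  proof (rule card_le_unit_ball_count[OF _ n a(1,2)])
    fix x y assume "x \<in> f ` A" "y \<in> f ` A"
    then show "euclid_dist n x y \<le> 2 * a"
      using diam' \<open>0 < u\<close> by (auto simp: f_def euclid_dist_divide pos_divide_le_eq)
  next
    fix p
    have "euclid_dist n (f x) p = euclid_dist n x (\<lambda>i. u * p i) / u" for x
      using euclid_dist_divide[OF \<open>0 < u\<close>, of n x "\<lambda>i. u * p i"] \<open>0 < u\<close> by (simp add: f_def)
    then have "{x \<in> f ` A. euclid_dist n x p \<le> 1} = f ` ?N (\<lambda>i. u * p i)"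
      using \<open>0 < u\<close> by auto
    then show "card {x \<in> f ` A. euclid_dist n x p \<le> 1} \<le> card (?N q)"
      using q by (simp add: card_image[OF inj])
  qed (use A in auto)
  also have "\<dots> \<le> 9 * (4 * real n ^ 2 + 1) * (243 * sqrt (3/2) ^ n) * real (card (?N q))"
    using sqrt_power_le[OF n _ a(3)] a(1) by (intro mult_right_mono mult_left_mono) auto
  finally show ?thesis
    unfolding u_def by (intro exI[of _ q]) (simp add: card_image[OF inj] clustering_bound_def algebra_simps)
qed

text \<open>
  An element that serves the fraction \<open>1/M\<close> of the points not yet served leaves at most the
  fraction \<open>1 - 1/M\<close> of them, so after \<open>m > M * ln (card A)\<close> steps fewer than one is left.
\<close>

lemma greedy_cover:
  fixes Q :: "'b \<Rightarrow> 'a \<Rightarrow> bool"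
  assumes A: "finite A" "A \<noteq> {}" and M: "1 \<le> M"
    and dense: "\<And>B. B \<subseteq> A \<Longrightarrow> \<exists>q. real (card B) \<le> M * real (card {x \<in> B. Q q x})"
  obtains P where "finite P" "real (card P) \<le> M * ln (real (card A)) + 1" "\<And>x. x \<in> A \<Longrightarrow> \<exists>q\<in>P. Q q x"
proof -
  have step: "\<exists>P. finite P \<and> card P \<le> m \<and>
      real (card {x \<in> A. \<not> (\<exists>q\<in>P. Q q x)}) \<le> real (card A) * (1 - 1 / M) ^ m" for m
  proof (induction m)
    case 0
    show ?case by (intro exI[of _ "{}"]) simp
  next
    case (Suc m)
    then obtain P where P: "finite P" "card P \<le> m"
      "real (card {x \<in> A. \<not> (\<exists>q\<in>P. Q q x)}) \<le> real (card A) * (1 - 1 / M) ^ m" by blast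
    let ?B = "{x \<in> A. \<not> (\<exists>q\<in>P. Q q x)}"
    obtain q where q: "real (card ?B) \<le> M * real (card {x \<in> ?B. Q q x})"
      using dense[of ?B] by auto
    have "{x \<in> A. \<not> (\<exists>q\<in>insert q P. Q q x)} = ?B - {x \<in> ?B. Q q x}" by auto
    moreover have "card (?B - {x \<in> ?B. Q q x}) = card ?B - card {x \<in> ?B. Q q x}"
      using A(1) by (intro card_Diff_subset) auto
    moreover have "card {x \<in> ?B. Q q x} \<le> card ?B" using A(1) by (intro card_mono) auto
    ultimately have "real (card {x \<in> A. \<not> (\<exists>q\<in>insert q P. Q q x)}) = real (card ?B) - real (card {x \<in> ?B. Q q x})"
      by (simp only: of_nat_diff)
    also have "\<dots> \<le> real (card ?B) * (1 - 1 / M)"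
      using q M by (simp add: field_simps)
    also have "\<dots> \<le> real (card A) * (1 - 1 / M) ^ m * (1 - 1 / M)"
      using P(3) M by (intro mult_right_mono) (auto simp: field_simps)
    finally show ?case using P card_insert_le_m1[of "Suc m" P q]
      by (intro exI[of _ "insert q P"]) (auto simp: mult_ac)
  qed
  define m where "m = nat \<lfloor>M * ln (real (card A))\<rfloor> + 1"
  have cA: "1 \<le> real (card A)" using A by (simp add: Suc_le_eq card_gt_0_iff)
  then have "0 \<le> M * ln (real (card A))" using M by simp
  then have m: "M * ln (real (card A)) < real m" "real m \<le> M * ln (real (card A)) + 1"
    unfolding m_def by linarith+
  obtain P where P: "finite P" "card P \<le> m"
      "real (card {x \<in> A. \<not> (\<exists>q\<in>P. Q q x)}) \<le> real (card A) * (1 - 1 / M) ^ m" using step by blast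
  have "(1 - 1 / M) ^ m \<le> exp (- 1 / M) ^ m"
    using M exp_ge_add_one_self[of "- 1 / M"] by (intro power_mono) (auto simp: field_simps)
  also have "\<dots> = exp (- (real m / M))" by (simp flip: exp_of_nat_mult)
  also have "\<dots> < exp (- ln (real (card A)))" using m M by (simp add: field_simps)
  also have "\<dots> = 1 / real (card A)" using cA by (simp add: exp_minus divide_inverse)
  finally have "real (card A) * (1 - 1 / M) ^ m < 1" using cA by (simp add: field_simps)
  with P(3) have "card {x \<in> A. \<not> (\<exists>q\<in>P. Q q x)} = 0" by linarith
  then have "{x \<in> A. \<not> (\<exists>q\<in>P. Q q x)} = {}" using A(1) by simp
  then show thesis using that[of P] P m(2) by (auto intro: order_trans[of _ "real m"])
qed

lemma euclid_dist_le_coordinatewise: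
  assumes "\<And>i. i < n \<Longrightarrow> \<bar>x i - y i\<bar> \<le> b"
  shows "euclid_dist n x y \<le> real n * b"
proof -
  have "euclid_dist n x y \<le> (\<Sum>i<n. \<bar>x i - y i\<bar>)"
    unfolding euclid_dist_def by (rule L2_set_le_sum_abs)
  also have "\<dots> \<le> (\<Sum>i<n. b)" using assms by (intro sum_mono) auto
  finally show ?thesis by simp
qed

lemma coordinate_le_euclid_dist:
  assumes "i < n"
  shows "\<bar>x i - y i\<bar> \<le> euclid_dist n x y"
  unfolding euclid_dist_def using assms member_le_L2_set[of "{..<n}" i "\<lambda>i. \<bar>x i - y i\<bar>"]
  by (simp add: L2_set_def)

text \<open>
  Points of \<open>C\<close> in the same cell of a cubical grid with side \<open>\<rho> / (2 * n\<^sup>2)\<close> are within \<open>n\<close>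
  times this side of each other. One point of \<open>C\<close> is kept for each cell that meets \<open>C\<close>; as
  they belong to \<open>C\<close>, they inherit any bound on the distances.
\<close>

lemma finite_net:
  assumes n: "1 \<le> n" and "0 < \<rho>" and "C \<noteq> {}"
    and diam: "\<And>x y. x \<in> C \<Longrightarrow> y \<in> C \<Longrightarrow> euclid_dist n x y \<le> 4 * \<rho>"
  obtains A where "A \<subseteq> C" "finite A" "A \<noteq> {}" "card A \<le> (16 * n\<^sup>2 + 1) ^ n"
    "\<And>c. c \<in> C \<Longrightarrow> \<exists>x\<in>A. euclid_dist n c x \<le> \<rho> / (2 * real n)"
proof -
  define N where "N = 2 * n\<^sup>2"
  have N: "0 < real N" using n by (simp add: N_def)
  obtain b where b: "b \<in> C" using assms(3) by blast
  define g where "g c = (\<lambda>i\<in>{..<n}. \<lfloor>(c i - b i) * real N / \<rho>\<rfloor>)" for c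
  define A where "A = inv_into C g ` g ` C"
  have "g ` C \<subseteq> (\<Pi>\<^sub>E i\<in>{..<n}. {- int (4 * N)..int (4 * N)})"
  proof (intro image_subsetI PiE_I)
    fix c i assume "c \<in> C" "i \<in> {..<n}"
    then have "\<bar>c i - b i\<bar> \<le> 4 * \<rho>"
      using coordinate_le_euclid_dist[of i n c b] diam[of c b] b by auto
    then have "\<bar>c i - b i\<bar> * real N / \<rho> \<le> 4 * \<rho> * real N / \<rho>"
      using N assms(2) by (intro divide_right_mono mult_right_mono) auto
    then have "\<bar>(c i - b i) * real N / \<rho>\<bar> \<le> 4 * real N"
      using assms(2) by (simp add: abs_mult)
    then have "- (4 * real N) \<le> (c i - b i) * real N / \<rho>" "(c i - b i) * real N / \<rho> < 4 * real N + 1"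
      by linarith+
    then show "g c i \<in> {- int (4 * N)..int (4 * N)}"
      using \<open>i \<in> _\<close> by (simp add: g_def le_floor_iff floor_le_iff)
  qed (simp add: g_def)
  moreover have fin: "finite (\<Pi>\<^sub>E i\<in>{..<n}. {- int (4 * N)..int (4 * N)})" by (intro finite_PiE) auto
  moreover have "card (\<Pi>\<^sub>E i\<in>{..<n}. {- int (4 * N)..int (4 * N)}) = (16 * n\<^sup>2 + 1) ^ n"
    by (subst card_PiE) (auto simp: N_def nat_add_distrib nat_mult_distrib nat_power_eq)
  ultimately have fg: "finite (g ` C)" "card (g ` C) \<le> (16 * n\<^sup>2 + 1) ^ n"
    using card_mono[OF fin, of "g ` C"] finite_subset[OF _ fin, of "g ` C"] by simp_all
  show thesis
  proof (rule that)
    show "A \<subseteq> C" unfolding A_def by (auto intro: inv_into_into)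
    show "finite A" "A \<noteq> {}" using fg b by (auto simp: A_def)
    show "card A \<le> (16 * n\<^sup>2 + 1) ^ n"
      unfolding A_def using card_image_le[OF fg(1)] fg(2) by (rule order_trans)
    fix c assume c: "c \<in> C"
    let ?x = "inv_into C g (g c)"
    have x: "g ?x = g c" by (rule f_inv_into_f[OF imageI[OF c]])
    have "euclid_dist n c ?x \<le> real n * (\<rho> / real N)"
    proof (rule euclid_dist_le_coordinatewise)
      fix i assume "i < n"
      then have "\<lfloor>(c i - b i) * real N / \<rho>\<rfloor> = \<lfloor>(?x i - b i) * real N / \<rho>\<rfloor>"
        using fun_cong[OF x, of i] by (simp add: g_def)
      then have "\<bar>(c i - b i) * real N / \<rho> - (?x i - b i) * real N / \<rho>\<bar> \<le> 1" by linarith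
      also have "(c i - b i) * real N / \<rho> - (?x i - b i) * real N / \<rho> = (c i - ?x i) * (real N / \<rho>)"
        using assms(2) by (simp add: field_simps)
      finally have "\<bar>c i - ?x i\<bar> * (real N / \<rho>) \<le> 1"
        using assms(2) by (simp add: abs_mult)
      then show "\<bar>c i - ?x i\<bar> \<le> \<rho> / real N"
        using N assms(2) by (simp add: pos_le_divide_eq pos_divide_le_eq)
    qed
    also have "\<dots> = \<rho> / (2 * real n)" using n by (simp add: N_def power2_eq_square)
    finally show "\<exists>x\<in>A. euclid_dist n c x \<le> \<rho> / (2 * real n)" using c by (auto simp: A_def)
  qed
qed

lemma clustering_bound_ge: "1 \<le> clustering_bound n"
proof -
  have "1 * 1 \<le> 2187 * (4 * real n ^ 2 + 1) * sqrt (3/2) ^ n"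
    by (intro mult_mono one_le_power) (auto simp: add_increasing)
  then show ?thesis by (simp add: clustering_bound_def)
qed

lemma cover_by_equal_balls:
  assumes n: "1 \<le> n" and "0 < \<rho>"
    and diam: "\<And>x y. x \<in> C \<Longrightarrow> y \<in> C \<Longrightarrow> euclid_dist n x y \<le> 2 * \<rho> * (1 + 1 / real n)"
  obtains P where "finite P" "real (card P) \<le> 17 * real n ^ 3 * clustering_bound n"
    "\<And>c. c \<in> C \<Longrightarrow> \<exists>p\<in>P. euclid_dist n c p \<le> \<rho>"
proof (cases "C = {}")
  case True
  then show thesis using that[of "{}"] clustering_bound_ge[of n] by simp
next
  case False
  have "\<rho> * (1 + 1 / real n) \<le> \<rho> * 2" using n assms(2) by (intro mult_left_mono) auto
  then have "euclid_dist n x y \<le> 4 * \<rho>" if "x \<in> C" "y \<in> C" for x y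
    using diam[OF that] by (simp add: mult.assoc)
  then obtain A where A: "A \<subseteq> C" "finite A" "A \<noteq> {}" "card A \<le> (16 * n\<^sup>2 + 1) ^ n"
    "\<And>c. c \<in> C \<Longrightarrow> \<exists>x\<in>A. euclid_dist n c x \<le> \<rho> / (2 * real n)"
    using finite_net[OF n assms(2) False] by blast
  let ?M = "clustering_bound n"
  have "\<exists>q. real (card B) \<le> ?M * real (card {x \<in> B. euclid_dist n x q \<le> \<rho> * (1 - 1 / (2 * real n))})"
    if "B \<subseteq> A" for B
  proof (rule exists_crowded_ball[OF _ n assms(2)])
    show "finite B" using that A(2) by (rule finite_subset)
  qed (use that A(1) diam in blast)
  then obtain P where P: "finite P" "real (card P) \<le> ?M * ln (real (card A)) + 1"
    "\<And>x. x \<in> A \<Longrightarrow> \<exists>q\<in>P. euclid_dist n x q \<le> \<rho> * (1 - 1 / (2 * real n))"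
    using greedy_cover[OF A(2,3) clustering_bound_ge[of n],
      of "\<lambda>q x. euclid_dist n x q \<le> \<rho> * (1 - 1 / (2 * real n))"] by blast
  have "0 < card A" using A by (simp add: card_gt_0_iff)
  then have "ln (real (card A)) \<le> ln (real ((16 * n\<^sup>2 + 1) ^ n))"
    using A(4) by (subst ln_le_cancel_iff) (auto simp del: of_nat_power)
  also have "\<dots> = real n * ln (1 + 16 * real n ^ 2)" by (simp add: ln_realpow add.commute)
  also have "\<dots> \<le> real n * (16 * real n ^ 2)" by (intro mult_left_mono ln_add_one_self_le_self) auto
  finally have "?M * ln (real (card A)) \<le> ?M * (16 * real n ^ 3)"
    using clustering_bound_ge[of n] by (intro mult_left_mono) (auto simp: power3_eq_cube power2_eq_square)
  moreover have "1 * 1 \<le> real n ^ 3 * ?M" using clustering_bound_ge[of n] n by (intro mult_mono one_le_power) auto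
  ultimately have "real (card P) \<le> 17 * real n ^ 3 * ?M" using P(2) by (simp add: mult_ac)
  moreover have "\<exists>p\<in>P. euclid_dist n c p \<le> \<rho>" if c: "c \<in> C" for c
  proof -
    obtain x where x: "x \<in> A" "euclid_dist n c x \<le> \<rho> / (2 * real n)" using A(5) c by blast
    obtain p where p: "p \<in> P" "euclid_dist n x p \<le> \<rho> * (1 - 1 / (2 * real n))" using P(3) x by blast
    have "euclid_dist n c p \<le> \<rho> / (2 * real n) + \<rho> * (1 - 1 / (2 * real n))"
      using x p euclid_dist_triangle[of n c p x] by linarith
    also have "\<dots> = \<rho>" by (simp add: algebra_simps)
    finally show ?thesis using p by blast
  qed
  ultimately show thesis using that P(1) by blast
qed

section \<open>Families of pairwise intersecting balls\<close>

lemma euclid_dist_self [simp]: "euclid_dist n x x = 0"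
  by (simp add: euclid_dist_def L2_set_def)

text \<open>
  A ball of radius \<open>r\<close> meeting the ball of radius \<open>\<rho>\<close> around \<open>o'\<close> contains a ball of radius
  \<open>n * \<rho>\<close> whose centre \<open>c'\<close> is close to \<open>o'\<close>: move the centre towards \<open>o'\<close> until the
  distance is \<open>n * \<rho> + \<rho>\<close>.
\<close>

lemma pull_centre:
  assumes "0 < n" "0 < \<rho>" "real n * \<rho> + \<rho> \<le> r" "euclid_dist n c o' \<le> r + \<rho>"
  obtains c' where "euclid_dist n c' o' \<le> real n * \<rho> + \<rho>" "euclid_dist n c c' \<le> r - real n * \<rho>"
proof (cases "euclid_dist n c o' \<le> real n * \<rho> + \<rho>")
  case True
  then show thesis using that[of c] assms by simp
next
  case False
  define d where "d = euclid_dist n c o'"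
  define v where "v = (\<lambda>i. c i - o' i)"
  define t where "t = (real n * \<rho> + \<rho>) / d"
  have d: "real n * \<rho> + \<rho> < d" "d \<le> r + \<rho>" using False assms by (auto simp: d_def)
  have "0 < real n * \<rho> + \<rho>" using assms by (simp add: add_nonneg_pos)
  with d have t: "0 \<le> t" "t \<le> 1" "t * d = real n * \<rho> + \<rho>" by (auto simp: t_def)
  have v: "euclid_dist n v (\<lambda>_. 0) = d" by (simp add: d_def v_def euclid_dist_def)
  show thesis
  proof (rule that)
    have "euclid_dist n (\<lambda>i. o' i + t * v i) (\<lambda>i. o' i + 0 * v i) = t * d"
      unfolding euclid_dist_along v using t by simp
    then show "euclid_dist n (\<lambda>i. o' i + t * v i) o' \<le> real n * \<rho> + \<rho>" using t by simp
    have "euclid_dist n (\<lambda>i. o' i + 1 * v i) (\<lambda>i. o' i + t * v i) = (1 - t) * d"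
      unfolding euclid_dist_along v using t by simp
    then have "euclid_dist n c (\<lambda>i. o' i + t * v i) = d - t * d" by (simp add: v_def left_diff_distrib)
    then show "euclid_dist n c (\<lambda>i. o' i + t * v i) \<le> r - real n * \<rho>" using t d by simp
  qed
qed

definition piercing_bound :: "nat \<Rightarrow> real"
  where "piercing_bound n = (real n ^ 2 + 1) * (17 * real n ^ 3 * clustering_bound n)"

text \<open>
  With \<open>\<rho>\<close> the smallest radius, the classes \<open>t j \<le> r \<le> t (j + 1)\<close> for \<open>j < n\<^sup>2\<close> reach beyond
  the radius \<open>n * \<rho> + \<rho>\<close> by Bernoulli's inequality, and each class is pierced by a cover of
  its centres by balls of radius \<open>t j\<close>. The larger balls are replaced by the balls of radius
  \<open>n * \<rho>\<close> that they contain near the smallest ball; the new centres are pairwise at distance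
  at most \<open>2 * (n * \<rho>) * (1 + 1/n)\<close>.
\<close>

lemma pierce_by_centres:
  assumes n: "1 \<le> n" and S: "finite S" and r: "\<And>F. F \<in> S \<Longrightarrow> 0 < r F"
    and meet: "\<And>F G. F \<in> S \<Longrightarrow> G \<in> S \<Longrightarrow> euclid_dist n (c F) (c G) \<le> r F + r G"
  obtains P where "finite P" "real (card P) \<le> piercing_bound n"
    "\<And>F. F \<in> S \<Longrightarrow> \<exists>p\<in>P. euclid_dist n (c F) p \<le> r F"
proof (cases "S = {}")
  case True
  have "0 \<le> piercing_bound n" using clustering_bound_ge[of n] by (simp add: piercing_bound_def)
  with True show thesis by (intro that[of "{}"]) auto
next
  case False
  obtain F0 where F0: "F0 \<in> S" "\<And>F. F \<in> S \<Longrightarrow> r F0 \<le> r F"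
    using finite_attains_max[OF S False, of "\<lambda>F. - r F"] by auto
  define \<rho> where "\<rho> = r F0"
  have \<rho>: "0 < \<rho>" using F0 r by (simp add: \<rho>_def)
  define t where "t j = \<rho> * (1 + 1 / real n) ^ j" for j
  have t_pos: "0 < t j" for j using \<rho> by (simp add: t_def add_pos_nonneg)
  let ?b = "17 * real n ^ 3 * clustering_bound n"
  have small: "\<exists>P. finite P \<and> real (card P) \<le> ?b \<and>
    (\<forall>F\<in>S. t j \<le> r F \<and> r F \<le> t (Suc j) \<longrightarrow> (\<exists>p\<in>P. euclid_dist n (c F) p \<le> r F))" for j
  proof -
    let ?C = "c ` {F \<in> S. t j \<le> r F \<and> r F \<le> t (Suc j)}"
    have "euclid_dist n x y \<le> 2 * t j * (1 + 1 / real n)" if xy: "x \<in> ?C" "y \<in> ?C" for x y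
    proof -
      obtain F G where FG: "F \<in> S" "r F \<le> t (Suc j)" "x = c F" "G \<in> S" "r G \<le> t (Suc j)" "y = c G"
        using xy by auto
      then have "euclid_dist n x y \<le> 2 * t (Suc j)" using meet[of F G] by simp
      also have "t (Suc j) = t j * (1 + 1 / real n)" by (simp add: t_def)
      finally show ?thesis by (simp only: mult.assoc)
    qed
    then obtain P where P: "finite P" "real (card P) \<le> ?b" "\<And>x. x \<in> ?C \<Longrightarrow> \<exists>p\<in>P. euclid_dist n x p \<le> t j"
      using cover_by_equal_balls[OF n t_pos] by blast
    have "\<exists>p\<in>P. euclid_dist n (c F) p \<le> r F" if "F \<in> S" "t j \<le> r F" "r F \<le> t (Suc j)" for F
      using P(3)[of "c F"] that order_trans by blast
    with P(1,2) show ?thesis by blast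
  qed
  define Q where "Q j = (SOME P. finite P \<and> real (card P) \<le> ?b \<and>
    (\<forall>F\<in>S. t j \<le> r F \<and> r F \<le> t (Suc j) \<longrightarrow> (\<exists>p\<in>P. euclid_dist n (c F) p \<le> r F)))" for j
  have Q: "finite (Q j) \<and> real (card (Q j)) \<le> ?b \<and>
    (\<forall>F\<in>S. t j \<le> r F \<and> r F \<le> t (Suc j) \<longrightarrow> (\<exists>p\<in>Q j. euclid_dist n (c F) p \<le> r F))" for j
    unfolding Q_def by (rule someI_ex[OF small])
  have tn: "real n * \<rho> + \<rho> \<le> t (n\<^sup>2)"
  proof -
    have "1 + real (n\<^sup>2) * (1 / real n) \<le> (1 + 1 / real n) ^ (n\<^sup>2)"
      by (rule Bernoulli_inequality) (rule order.trans[of _ 0], simp_all)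
    moreover have "real (n\<^sup>2) * (1 / real n) = real n" using n by (simp add: power2_eq_square)
    ultimately have "\<rho> * (1 + real n) \<le> t (n\<^sup>2)" using \<rho> by (simp add: t_def mult_left_mono)
    then show ?thesis by (simp add: algebra_simps)
  qed
  let ?big = "{F \<in> S. t (n\<^sup>2) \<le> r F}"
  have "\<exists>c'. euclid_dist n c' (c F0) \<le> real n * \<rho> + \<rho> \<and> euclid_dist n (c F) c' \<le> r F - real n * \<rho>"
    if "F \<in> ?big" for F
  proof -
    have "real n * \<rho> + \<rho> \<le> r F" "euclid_dist n (c F) (c F0) \<le> r F + \<rho>"
      using that tn meet[of F F0] F0(1) by (auto simp: \<rho>_def)
    then show ?thesis using pull_centre[of n \<rho> "r F" "c F" "c F0"] n \<rho> by auto
  qed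
  then obtain c' where c': "\<And>F. F \<in> ?big \<Longrightarrow> euclid_dist n (c' F) (c F0) \<le> real n * \<rho> + \<rho>"
    "\<And>F. F \<in> ?big \<Longrightarrow> euclid_dist n (c F) (c' F) \<le> r F - real n * \<rho>"
    by metis
  have "euclid_dist n x y \<le> 2 * (real n * \<rho>) * (1 + 1 / real n)" if xy: "x \<in> c' ` ?big" "y \<in> c' ` ?big" for x y
  proof -
    have "euclid_dist n x (c F0) \<le> real n * \<rho> + \<rho>" "euclid_dist n y (c F0) \<le> real n * \<rho> + \<rho>"
      using xy c'(1) by auto
    then have "euclid_dist n x y \<le> 2 * (real n * \<rho> + \<rho>)"
      using euclid_dist_triangle[of n x y "c F0"] euclid_dist_commute[of n y "c F0"] by simp
    also have "\<dots> = 2 * (real n * \<rho>) * (1 + 1 / real n)" using n by (simp add: field_simps)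
    finally show ?thesis .
  qed
  moreover have n\<rho>: "0 < real n * \<rho>" using n \<rho> by simp
  ultimately obtain P where P: "finite P" "real (card P) \<le> ?b"
    "\<And>x. x \<in> c' ` ?big \<Longrightarrow> \<exists>p\<in>P. euclid_dist n x p \<le> real n * \<rho>"
    using cover_by_equal_balls[OF n n\<rho>, of "c' ` ?big"] by blast
  show thesis
  proof (rule that[of "P \<union> (\<Union>j<n\<^sup>2. Q j)"])
    show "finite (P \<union> (\<Union>j<n\<^sup>2. Q j))" using P(1) Q by auto
    have "real (card (P \<union> (\<Union>j<n\<^sup>2. Q j))) \<le> real (card P + (\<Sum>j<n\<^sup>2. card (Q j)))"
      unfolding of_nat_le_iff by (rule order_trans[OF card_Un_le add_left_mono[OF card_UN_le]]) simp
    also have "\<dots> \<le> ?b + (\<Sum>j<n\<^sup>2. ?b)"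
      unfolding of_nat_add of_nat_sum using P(2) Q by (intro add_mono sum_mono) auto
    also have "\<dots> = piercing_bound n" by (simp add: piercing_bound_def algebra_simps)
    finally show "real (card (P \<union> (\<Union>j<n\<^sup>2. Q j))) \<le> piercing_bound n" .
    fix F assume F: "F \<in> S"
    show "\<exists>p\<in>P \<union> (\<Union>j<n\<^sup>2. Q j). euclid_dist n (c F) p \<le> r F"
    proof (cases "t (n\<^sup>2) \<le> r F")
      case True
      then have big: "F \<in> ?big" using F by simp
      then obtain p where p: "p \<in> P" "euclid_dist n (c' F) p \<le> real n * \<rho>" using P(3) by blast
      then have "euclid_dist n (c F) p \<le> r F"
        using c'(2)[OF big] euclid_dist_triangle[of n "c F" p "c' F"] by linarith
      then show ?thesis using p by blast
    next
      case False
      have "t 0 \<le> r F" using F0(2)[OF F] by (simp add: t_def \<rho>_def)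
      then have "\<exists>j<n\<^sup>2. t j \<le> r F \<and> \<not> t (Suc j) \<le> r F"
        using False inc_induct[of 0 "n\<^sup>2" "\<lambda>j. \<not> t j \<le> r F"] by (meson zero_le)
      then obtain j where j: "j < n\<^sup>2" "t j \<le> r F" "r F \<le> t (Suc j)" by auto
      then obtain p where "p \<in> Q j" "euclid_dist n (c F) p \<le> r F" using Q[of j] F by blast
      with j show ?thesis by blast
    qed
  qed
qed

section \<open>The piercing number\<close>

lemma infinite_euclid:
  assumes "1 \<le> n"
  shows "infinite (euclid n)"
proof
  assume "finite (euclid n)"
  moreover have "range (\<lambda>x i. if i = 0 then x else 0 :: real) \<subseteq> euclid n"
    using assms by (auto simp: topspace_Euclidean_space)
  ultimately have "finite (range (\<lambda>x i. if i = (0::nat) then x else 0 :: real))"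
    by (rule finite_subset[rotated])
  moreover have "inj (\<lambda>x i. if i = (0::nat) then x else 0 :: real)"
    by (rule injI) (metis (full_types))
  ultimately have "finite (UNIV :: real set)" by (rule finite_imageD)
  then show False using infinite_UNIV_char_0 by blast
qed

text \<open>
  The points found so far may have non-zero coordinates from \<open>n\<close> on, which do not influence
  distances and are cut off. To reach the cardinality \<open>k\<close> exactly, further points of the
  infinite space are added.
\<close>

lemma suffices_to_pierce_of_bound:
  assumes n: "1 \<le> n" and k: "piercing_bound n \<le> real k"
  shows "suffices_to_pierce n k"
  unfolding suffices_to_pierce_def
proof (intro allI impI)
  fix \<F> assume F: "intersecting_ball_family n \<F>"
  then have "\<forall>B\<in>\<F>. \<exists>c r. c \<in> euclid n \<and> 0 < r \<and> B = euclid.mcball n c r"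
    unfolding intersecting_ball_family_def is_closed_ball_def by blast
  then obtain c r where cr: "\<And>B. B \<in> \<F> \<Longrightarrow> c B \<in> euclid n" "\<And>B. B \<in> \<F> \<Longrightarrow> 0 < r B"
    "\<And>B. B \<in> \<F> \<Longrightarrow> B = euclid.mcball n (c B) (r B)" by metis
  have mem: "x \<in> B \<longleftrightarrow> x \<in> euclid n \<and> euclid_dist n (c B) x \<le> r B" if "B \<in> \<F>" for B x
    using cr(1,3)[OF that] euclid.in_mcball by blast
  have meet: "euclid_dist n (c A) (c B) \<le> r A + r B" if AB: "A \<in> \<F>" "B \<in> \<F>" for A B
  proof (cases "A = B")
    case True
    then show ?thesis using cr(2)[OF AB(2)] by simp
  next
    case False
    then obtain x where "x \<in> A" "x \<in> B"
      using F AB unfolding intersecting_ball_family_def pairwise_def by blast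
    then have "euclid_dist n (c A) x \<le> r A" "euclid_dist n (c B) x \<le> r B" using mem AB by auto
    then show ?thesis
      using euclid_dist_triangle[of n "c A" "c B" x] euclid_dist_commute[of n x "c B"] by linarith
  qed
  have "finite \<F>" using F by (simp add: intersecting_ball_family_def)
  then obtain P where P: "finite P" "real (card P) \<le> piercing_bound n"
    "\<And>B. B \<in> \<F> \<Longrightarrow> \<exists>p\<in>P. euclid_dist n (c B) p \<le> r B"
    using pierce_by_centres[OF n, of \<F> r c] cr(2) meet by blast
  define cut where "cut p = (\<lambda>i. if i < n then p i else 0)" for p :: "nat \<Rightarrow> real"
  have cut: "cut p \<in> euclid n" "euclid_dist n x (cut p) = euclid_dist n x p" for p x
    by (auto simp: cut_def topspace_Euclidean_space euclid_dist_def intro!: L2_set_cong)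
  have "card (cut ` P) \<le> k" using card_image_le[OF P(1), of cut] P(2) k by linarith
  obtain R where R: "R \<subseteq> euclid n - cut ` P" "finite R" "card R = k - card (cut ` P)"
    using infinite_arbitrarily_large[OF Diff_infinite_finite[OF finite_imageI[OF P(1), of cut] infinite_euclid[OF n]]]
    by metis
  show "\<exists>P. P \<subseteq> euclid n \<and> finite P \<and> card P = k \<and> pierces P \<F>"
  proof (intro exI[of _ "cut ` P \<union> R"] conjI)
    show "cut ` P \<union> R \<subseteq> euclid n" using R cut by auto
    show "finite (cut ` P \<union> R)" using R P by simp
    show "card (cut ` P \<union> R) = k"
      using R P \<open>card (cut ` P) \<le> k\<close> by (subst card_Un_disjoint) auto
    show "pierces (cut ` P \<union> R) \<F>"
      unfolding pierces_def
    proof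
      fix B assume B: "B \<in> \<F>"
      obtain p where "p \<in> P" "euclid_dist n (c B) p \<le> r B" using P(3) B by blast
      then have "cut p \<in> B" using mem[OF B] cut by simp
      with \<open>p \<in> P\<close> show "(cut ` P \<union> R) \<inter> B \<noteq> {}" by blast
    qed
  qed
qed

lemma piercing_bound_le:
  assumes "1 \<le> n"
  shows "piercing_bound n + 1 \<le> 10 ^ 6 * real n ^ 7 * sqrt (3/2) ^ n"
proof -
  have n: "1 \<le> real n" "1 \<le> real n ^ 2" using assms by auto
  have "piercing_bound n \<le> (2 * real n ^ 2) * (17 * real n ^ 3 * (2187 * (5 * real n ^ 2) * sqrt (3/2) ^ n))"
    unfolding piercing_bound_def clustering_bound_def
    using n by (intro mult_mono) auto
  also have "\<dots> = 371790 * (real n ^ 7 * sqrt (3/2) ^ n)" by (simp add: power_def eval_nat_numeral)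
  finally have "piercing_bound n \<le> 371790 * (real n ^ 7 * sqrt (3/2) ^ n)" .
  moreover have "1 * 1 \<le> real n ^ 7 * sqrt (3/2) ^ n" using n by (intro mult_mono one_le_power) auto
  ultimately show ?thesis by simp
qed

theorem theorem1:
  shows "(\<forall>n\<ge>1. suffices_to_pierce n (ball_piercing_number n)) \<and>
    (\<exists>\<epsilon> :: nat \<Rightarrow> real. \<epsilon> \<in> o(\<lambda>_. 1) \<and>
      (\<forall>n\<ge>1. real (ball_piercing_number n) \<le> (sqrt (3/2) + \<epsilon> n) ^ n))"
proof (intro conjI allI impI)
  fix n :: nat assume n: "1 \<le> n"
  show "suffices_to_pierce n (ball_piercing_number n)"
    unfolding ball_piercing_number_def
    by (rule LeastI, rule suffices_to_pierce_of_bound[OF n real_nat_ceiling_ge])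
next
  \<comment> \<open>The choice that makes \<open>(sqrt (3/2) + \<epsilon> n) ^ n\<close> equal to \<open>10 ^ 6 * n ^ 7 * sqrt (3/2) ^ n\<close>.\<close>
  define \<epsilon> where "\<epsilon> n = sqrt (3/2) * (root n (10 ^ 6) * root n (real n) ^ 7 - 1)" for n
  have "\<epsilon> \<longlonglongrightarrow> sqrt (3/2) * (1 * 1 ^ 7 - 1)"
    unfolding \<epsilon>_def by (intro tendsto_intros LIMSEQ_root LIMSEQ_root_const) simp
  then have "\<epsilon> \<in> o(\<lambda>_. 1)" by (intro smalloI_tendsto) auto
  moreover have "real (ball_piercing_number n) \<le> (sqrt (3/2) + \<epsilon> n) ^ n" if n: "1 \<le> n" for n
  proof -
    have "ball_piercing_number n \<le> nat \<lceil>piercing_bound n\<rceil>"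
      unfolding ball_piercing_number_def
      by (rule Least_le) (rule suffices_to_pierce_of_bound[OF n real_nat_ceiling_ge])
    moreover have "0 \<le> piercing_bound n"
      using clustering_bound_ge[of n] by (simp add: piercing_bound_def)
    ultimately have "real (ball_piercing_number n) \<le> piercing_bound n + 1" by linarith
    also have "\<dots> \<le> 10 ^ 6 * real n ^ 7 * sqrt (3/2) ^ n" by (rule piercing_bound_le[OF n])
    also have "\<dots> = (sqrt (3/2) * (root n (10 ^ 6) * root n (real n) ^ 7)) ^ n"
    proof -
      have "(root n (real n) ^ 7) ^ n = (root n (real n) ^ n) ^ 7"
        by (simp only: power_mult[symmetric] mult.commute)
      also have "\<dots> = real n ^ 7" using n by simp
      finally show ?thesis using n by (simp add: power_mult_distrib)
    qed
    also have "\<dots> = (sqrt (3/2) + \<epsilon> n) ^ n" by (simp add: \<epsilon>_def algebra_simps)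
    finally show ?thesis .
  qed
  ultimately show "\<exists>\<epsilon> :: nat \<Rightarrow> real. \<epsilon> \<in> o(\<lambda>_. 1) \<and>
      (\<forall>n\<ge>1. real (ball_piercing_number n) \<le> (sqrt (3/2) + \<epsilon> n) ^ n)" by blast
qed

end
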